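(* (i) Let $T\subset\mathbb{R}^d$ be compact, let $X=(X(t),\,t\in T)$ be a real-valued centered Gaussian random field on $T$ with continuous sample paths, and let $a\neq b$ be points of $T$ such that $T$ contains some path from $a$ to $b$. Set $$\Psi_{a,b}(u)=P\big(\exists\,\xi\in\mathcal{P}(a,b):\ \xi(v)\in T \text{ and } X(\xi(v))>u \text{ for all } 0\le v\le 1\big).$$ Then $$\lim_{u\to\infty}\frac{1}{u^2}\log\Psi_{a,b}(u)=-\frac12\, C_X(a,b),$$ where $$C_X(a,b)=\inf\big\{E H^2:\ H\in\mathcal{L},\ \text{and for some } \xi\in\mathcal{P}(a,b),\ \xi(v)\in T \text{ and } w_H(\xi(v))>1 \text{ for all } 0\le v\le 1\big\}.$$ (ii) Let $X=(X(t),\,t\in\mathbb{R}^d)$ be a real-valued centered stationary Gaussian random field with continuous sample paths, covariance function $R_X(t)=\mathrm{Cov}(X(0),X(t))$ and spectral measure $F_X$, and assume $\limsup_{\|t\|\to\infty}R_X(t)\le 0$. Let $a\in\mathbb{R}^d$, $a\ne 0$, and $\Psi_a(u)=P(\exists\,\xi\in\mathcal{P}(0,a):\ X(\xi(v))>u \text{ for all } 0\le v\le1)$. Then $$\lim_{u\to\infty}\frac{1}{u^2}\log\Psi_a(u)=-\frac12\,C_X(a),$$ where $$C_X(a)=\inf\Big\{\int_{\mathbb{R}^d}|h(x)|^2F_X(dx):\ h\in\mathcal{H}_F,\ \text{and for some }\xi\in\mathcal{P}(0,a),\ \int_{\mathbb{R}^d}e^{i(\xi(v),x)}\overline{h(x)}\,F_X(dx)>1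 \text{ for all } 0\le v\le 1\Big\}.$$
   Context: For $a,b\in\mathbb{R}^d$, $\mathcal{P}(a,b)$ is the set of paths from $a$ to $b$, i.e. continuous maps $\xi:[0,1]\to\mathbb{R}^d$ with $\xi(0)=a$, $\xi(1)=b$. For a field $X$ on a parameter set $T$, $\mathcal{L}$ denotes the closure in $L^2(P)$ of the set of finite linear combinations $\sum_j a_jX(t_j)$ ($a_j\in\mathbb{R}$, $t_j\in T$), and for $H\in\mathcal{L}$, $w_H(t)=E(X(t)H)$, $t\in T$. In the stationary case the spectral measure $F_X$ is the finite symmetric Borel measure on $\mathbb{R}^d$ with $R_X(t)=\int e^{i(t,x)}F_X(dx)$, and $\mathcal{H}_F$ denotes the set of functions $h\in L^2(F_X)$ (complex-valued) with even real part and odd imaginary part. The infimum of an empty set is $+\infty$ (so the limit is then $-\infty$). *)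

theory Defs
  imports "HOL-Probability.Probability"
begin

(* Outer probability P^*(A) = inf { P(B) : B measurable, A \<subseteq> B }.
   Used for the excursion probabilities, whose events need not be
   obviously measurable (they are universally measurable, so P^* agrees
   with the completed probability). *)
definition outer_prob :: "'a measure \<Rightarrow> 'a set \<Rightarrow> real" where
  "outer_prob M A = (INF B \<in> {B \<in> sets M. A \<subseteq> B}. measure M B)"

definition eln :: "real \<Rightarrow> ereal" where
  "eln x = (if 0 < x then ereal (ln x) else - \<infinity>)"

definition paths_from_to :: "'d::euclidean_space \<Rightarrow> 'd \<Rightarrow> (real \<Rightarrow> 'd) set" where
  "paths_from_to a b = {\<xi>. continuous_on {0..1} \<xi> \<and> \<xi> 0 = a \<and> \<xi> 1 = b}"

definition centered_normal_rv :: "'a measure \<Rightarrow> ('a \<Rightarrow> real) \<Rightarrow> bool" where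
  "centered_normal_rv M Y \<longleftrightarrow> Y \<in> borel_measurable M \<and>
     ((AE \<omega> in M. Y \<omega> = 0) \<or>
      (\<exists>\<sigma>>0. distributed M lborel Y (\<lambda>x. ennreal (normal_density 0 \<sigma> x))))"

definition lin_comb :: "('d \<Rightarrow> 'a \<Rightarrow> real) \<Rightarrow> 'd set \<Rightarrow> ('a \<Rightarrow> real) \<Rightarrow> bool" where
  "lin_comb X T Y \<longleftrightarrow> (\<exists>(n::nat) c t. (\<forall>i<n. t i \<in> T) \<and> Y = (\<lambda>\<omega>. \<Sum>i<n. c i * X (t i) \<omega>))"

definition centered_gaussian_field ::
    "'a measure \<Rightarrow> ('d \<Rightarrow> 'a \<Rightarrow> real) \<Rightarrow> 'd set \<Rightarrow> bool" where
  "centered_gaussian_field M X T \<longleftrightarrow>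
     (\<forall>t\<in>T. X t \<in> borel_measurable M) \<and>
     (\<forall>Y. lin_comb X T Y \<longrightarrow> centered_normal_rv M Y)"

definition continuous_paths :: "'a measure \<Rightarrow> ('d::topological_space \<Rightarrow> 'a \<Rightarrow> real) \<Rightarrow> 'd set \<Rightarrow> bool" where
  "continuous_paths M X T \<longleftrightarrow> (\<forall>\<omega>\<in>space M. continuous_on T (\<lambda>t. X t \<omega>))"

(* H \<in> \<L>: closure in L^2(P) of the finite linear combinations (H a representative) *)
definition in_L :: "'a measure \<Rightarrow> ('d \<Rightarrow> 'a \<Rightarrow> real) \<Rightarrow> 'd set \<Rightarrow> ('a \<Rightarrow> real) \<Rightarrow> bool" where
  "in_L M X T H \<longleftrightarrow> H \<in> borel_measurable M \<and> integrable M (\<lambda>\<omega>. (H \<omega>)\<^sup>2) \<and>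
     (\<exists>Y. (\<forall>n. lin_comb X T (Y n)) \<and>
          (\<lambda>n. integral\<^sup>L M (\<lambda>\<omega>. (Y n \<omega> - H \<omega>)\<^sup>2)) \<longlonglongrightarrow> 0)"

definition w_H :: "'a measure \<Rightarrow> ('d \<Rightarrow> 'a \<Rightarrow> real) \<Rightarrow> ('a \<Rightarrow> real) \<Rightarrow> 'd \<Rightarrow> real" where
  "w_H M X H t = integral\<^sup>L M (\<lambda>\<omega>. X t \<omega> * H \<omega>)"

definition Psi_ab :: "'a measure \<Rightarrow> ('d::euclidean_space \<Rightarrow> 'a \<Rightarrow> real) \<Rightarrow> 'd set \<Rightarrow> 'd \<Rightarrow> 'd \<Rightarrow> real \<Rightarrow> real" where
  "Psi_ab M X T a b u = outer_prob M {\<omega> \<in> space M. \<exists>\<xi>\<in>paths_from_to a b.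
       \<forall>v\<in>{0..1}. \<xi> v \<in> T \<and> X (\<xi> v) \<omega> > u}"

definition C_ab :: "'a measure \<Rightarrow> ('d::euclidean_space \<Rightarrow> 'a \<Rightarrow> real) \<Rightarrow> 'd set \<Rightarrow> 'd \<Rightarrow> 'd \<Rightarrow> ereal" where
  "C_ab M X T a b = Inf {ereal (integral\<^sup>L M (\<lambda>\<omega>. (H \<omega>)\<^sup>2)) | H. in_L M X T H \<and>
       (\<exists>\<xi>\<in>paths_from_to a b. \<forall>v\<in>{0..1}. \<xi> v \<in> T \<and> w_H M X H (\<xi> v) > 1)}"

definition cov_fun :: "'a measure \<Rightarrow> ('d::euclidean_space \<Rightarrow> 'a \<Rightarrow> real) \<Rightarrow> 'd \<Rightarrow> real" where
  "cov_fun M X t = integral\<^sup>L M (\<lambda>\<omega>. X 0 \<omega> * X t \<omega>)"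

definition stationary_cov :: "'a measure \<Rightarrow> ('d::euclidean_space \<Rightarrow> 'a \<Rightarrow> real) \<Rightarrow> bool" where
  "stationary_cov M X \<longleftrightarrow>
     (\<forall>s t. integral\<^sup>L M (\<lambda>\<omega>. X s \<omega> * X t \<omega>) = cov_fun M X (t - s))"

definition spectral_measure_of ::
    "'a measure \<Rightarrow> ('d::euclidean_space \<Rightarrow> 'a \<Rightarrow> real) \<Rightarrow> 'd measure \<Rightarrow> bool" where
  "spectral_measure_of M X F \<longleftrightarrow> sets F = sets borel \<and> finite_measure F \<and>
     (\<forall>A\<in>sets borel. emeasure F (uminus ` A) = emeasure F A) \<and>
     (\<forall>t. complex_of_real (cov_fun M X t) = integral\<^sup>L F (\<lambda>x. cis (t \<bullet> x)))"

definition H_F :: "'d::euclidean_space measure \<Rightarrow> ('d \<Rightarrow> complex) set" where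
  "H_F F = {h. h \<in> borel_measurable F \<and> integrable F (\<lambda>x. (cmod (h x))\<^sup>2) \<and>
     (\<forall>x. Re (h (- x)) = Re (h x)) \<and> (\<forall>x. Im (h (- x)) = - Im (h x))}"

definition Psi_a :: "'a measure \<Rightarrow> ('d::euclidean_space \<Rightarrow> 'a \<Rightarrow> real) \<Rightarrow> 'd \<Rightarrow> real \<Rightarrow> real" where
  "Psi_a M X a u = outer_prob M {\<omega> \<in> space M. \<exists>\<xi>\<in>paths_from_to 0 a.
       \<forall>v\<in>{0..1}. X (\<xi> v) \<omega> > u}"

(* C_X(a); "> 1" for a complex number read as: real and > 1 *)
definition C_a :: "'d::euclidean_space measure \<Rightarrow> 'd \<Rightarrow> ereal" where
  "C_a F a = Inf {ereal (integral\<^sup>L F (\<lambda>x. (cmod (h x))\<^sup>2)) | h. h \<in> H_F F \<and>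
       (\<exists>\<xi>\<in>paths_from_to 0 a. \<forall>v\<in>{0..1}.
          Im (integral\<^sup>L F (\<lambda>x. cis (\<xi> v \<bullet> x) * cnj (h x))) = 0 \<and>
          Re (integral\<^sup>L F (\<lambda>x. cis (\<xi> v \<bullet> x) * cnj (h x))) > 1)}"

end

theory Submission
  imports Defs
begin

text \<open>For a set \<open>K\<close> let \<open>v(K)\<close> be the infimum of the variances of the convex combinations of
  \<open>X(t)\<close>, \<open>t \<in> K\<close>. The first-order condition for near-minimisers, together with the Cauchy-Schwarz
  inequality, shows that \<open>1 / v(K)\<close> is the infimum of \<open>E H\<^sup>2\<close> over all \<open>H\<close> with \<open>w\<^sub>H > 1\<close> on \<open>K\<close>,
  and also the infimum of the spectral norms in the stationary case. Hence the constant of the theorem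
  is \<open>1 / sup v(K)\<close> over the path images \<open>K\<close>.

  Lower bound: if \<open>w\<^sub>H \<ge> 1\<close> on \<open>K\<close> and \<open>q = E H\<^sup>2\<close>, then \<open>X(t) = w\<^sub>H(t) H / q + Z(t)\<close> with \<open>Z\<close>
  independent of \<open>H\<close>, so \<open>X > u\<close> on \<open>K\<close> has at least about the probability of \<open>H > q u\<close>.

  Upper bound: Fernique's theorem, applied to the modulus of continuity of \<open>X\<close> at a small scale, shows
  that up to an event of negligible probability only finitely many representative sets \<open>K\<close> matter; on
  each of them a convex combination of variance about \<open>v(K)\<close> must exceed about \<open>u\<close>.

  In the stationary case a path that leaves a large ball passes through many points that are far
  apart, and the variance of the average of \<open>X\<close> over these points is small.\<close>

section \<open>Uniqueness of joint laws\<close>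

text \<open>Infima over \<open>in_L\<close> or \<open>H_F\<close> need not be attained, and the
  joint law of an element of the closure with the field is not directly available. Minimal variances
  of convex combinations avoid both obstacles: an admissible element of either class only has to
  supply an inequality for finite convex combinations, and this is turned back into an admissible
  finite linear combination with arbitrarily small loss. All probabilistic arguments then concern
  finite linear combinations, which are centered normal by hypothesis; independence and rotation
  invariance are read off characteristic functions.

  A union bound over uncountably many paths fails, and excursion sets need not be measurable. Every
  estimate therefore produces an event that contains the excursion set or is contained in it, which
  is what \<open>outer_prob\<close> can be compared with. The strict gaps between rates absorb the
  finite number of sets, the oscillation of the field and the prefactors.\<close>

lemma integrable_bounded_finite_measure:
  fixes f :: "'a \<Rightarrow> 'b::{banach,second_countable_topology}"
  assumes "finite_measure M" "f \<in> borel_measurable M" "\<And>x. norm (f x) \<le> c"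
  shows "integrable M f"
proof -
  interpret finite_measure M by fact
  show ?thesis using assms by (intro integrable_const_bound[where B = c]) auto
qed

text \<open>At \<open>s = 0\<close> the hypothesis \<open>eq\<close> equates the total masses.
  Dividing by the common mass \<open>m\<close> makes the weights probability densities, to which
  Levy's uniqueness theorem applies; mass zero cannot be normalised, but then both weights vanish
  almost everywhere.\<close>

lemma weighted_charfun_unique:
  fixes V :: "'a \<Rightarrow> real" and W :: "'b \<Rightarrow> real"
  assumes fm: "finite_measure M" "finite_measure N"
    and [measurable]: "V \<in> borel_measurable M" "W \<in> borel_measurable N"
    and [measurable]: "f \<in> borel_measurable M" "g \<in> borel_measurable N"
    and f: "\<And>x. 0 \<le> f x" "\<And>x. f x \<le> (c::real)" and g: "\<And>x. 0 \<le> g x" "\<And>x. g x \<le> (c::real)"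
    and eq: "\<And>s. (\<integral>x. of_real (f x) * iexp (s * V x) \<partial>M) = (\<integral>x. of_real (g x) * iexp (s * W x) \<partial>N)"
    and B[measurable]: "B \<in> sets borel"
  shows "(\<integral>x. f x * indicator B (V x) \<partial>M) = (\<integral>x. g x * indicator B (W x) \<partial>N)"
proof -
  have intf: "integrable M f"
    using f by (intro integrable_bounded_finite_measure[OF fm(1), of _ c]) auto
  have intg: "integrable N g"
    using g by (intro integrable_bounded_finite_measure[OF fm(2), of _ c]) auto
  define m where "m = (\<integral>x. f x \<partial>M)"
  have m2: "m = (\<integral>x. g x \<partial>N)"
  proof -
    have "complex_of_real m = of_real (\<integral>x. g x \<partial>N)" using eq[of 0] by (simp add: m_def)
    then show ?thesis using of_real_eq_iff by blast
  qed
  have "0 \<le> m" unfolding m_def using f by simp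
  then consider "m = 0" | "m > 0" by fastforce
  then show ?thesis
  proof cases
    case 1
    then have 0: "(\<integral>x. f x \<partial>M) = 0" "(\<integral>x. g x \<partial>N) = 0" using m_def m2 by simp_all
    have "AE x in M. f x = 0" 
      using integral_nonneg_eq_0_iff_AE[OF intf] 0(1) f(1) by simp
    then have "(\<integral>x. f x * indicator B (V x) \<partial>M) = 0" 
      by (intro integral_eq_zero_AE) (elim AE_mp, simp)
    moreover have "AE x in N. g x = 0" 
      using integral_nonneg_eq_0_iff_AE[OF intg] 0(2) g(1) by simp
    then have "(\<integral>x. g x * indicator B (W x) \<partial>N) = 0" 
      by (intro integral_eq_zero_AE) (elim AE_mp, simp)
    ultimately show ?thesis by simp
  next
    case 2
    have nf: "0 \<le> f x / m" and ng: "0 \<le> g y / m" for x y using f g 2 by auto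
    define M' where "M' = density M (\<lambda>x. ennreal (f x / m))"
    define N' where "N' = density N (\<lambda>x. ennreal (g x / m))"
    have [measurable]: "V \<in> borel_measurable M'" "W \<in> borel_measurable N'"
      by (auto simp: M'_def N'_def)
    have pM: "prob_space M'"
    proof
      have "(\<integral>\<^sup>+x. ennreal (f x / m) \<partial>M) = ennreal (\<integral>x. f x / m \<partial>M)"
        using intf nf by (intro nn_integral_eq_integral) auto
      then show "emeasure M' (space M') = 1"
        using 2 by (simp add: M'_def emeasure_density m_def[symmetric] cong: nn_integral_cong)
    qed
    have pN: "prob_space N'"
    proof
      have "(\<integral>\<^sup>+x. ennreal (g x / m) \<partial>N) = ennreal (\<integral>x. g x / m \<partial>N)"
        using intg ng by (intro nn_integral_eq_integral) auto
      then show "emeasure N' (space N') = 1"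
        using 2 by (simp add: N'_def emeasure_density m2[symmetric] cong: nn_integral_cong)
    qed
    have "char (distr M' borel V) s = char (distr N' borel W) s" for s
    proof -
      have "char (distr M' borel V) s = (\<integral>x. (f x / m) *\<^sub>R iexp (s * V x) \<partial>M)"
        unfolding char_def M'_def using nf by (simp add: integral_distr integral_density)
      also have "\<dots> = (\<integral>x. (1/m) *\<^sub>R (of_real (f x) * iexp (s * V x)) \<partial>M)"
        by (simp add: scaleR_conv_of_real)
      also have "\<dots> = (1/m) *\<^sub>R (\<integral>x. of_real (f x) * iexp (s * V x) \<partial>M)"
        by (rule integral_scaleR_right)
      also have "\<dots> = (1/m) *\<^sub>R (\<integral>x. of_real (g x) * iexp (s * W x) \<partial>N)" by (simp only: eq)
      also have "\<dots> = (\<integral>x. (1/m) *\<^sub>R (of_real (g x) * iexp (s * W x)) \<partial>N)"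
        by (rule integral_scaleR_right[symmetric])
      also have "\<dots> = (\<integral>x. (g x / m) *\<^sub>R iexp (s * W x) \<partial>N)"
        by (simp add: scaleR_conv_of_real)
      also have "\<dots> = char (distr N' borel W) s"
        unfolding char_def N'_def using ng by (simp add: integral_distr integral_density)
      finally show ?thesis .
    qed
    then have eqD: "distr M' borel V = distr N' borel W"
      using pM pN by (intro Levy_uniqueness prob_space.real_distribution_distr ext) auto
    have "(\<integral>x. f x * indicat_real B (V x) \<partial>M) = m * (\<integral>x. (f x / m) *\<^sub>R indicat_real B (V x) \<partial>M)"
      using 2 by simp
    also have "(\<integral>x. (f x / m) *\<^sub>R indicat_real B (V x) \<partial>M) = (\<integral>x. indicat_real B (V x) \<partial>M')"
      unfolding M'_def by (subst integral_density) (auto simp: nf)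
    also have "\<dots> = (\<integral>x. indicat_real B x \<partial>distr M' borel V)"
      by (subst integral_distr) auto
    also have "\<dots> = (\<integral>x. indicat_real B x \<partial>distr N' borel W)" by (simp add: eqD)
    also have "\<dots> = (\<integral>x. indicat_real B (W x) \<partial>N')"
      by (subst integral_distr) auto
    also have "\<dots> = (\<integral>x. (g x / m) *\<^sub>R indicat_real B (W x) \<partial>N)"
      unfolding N'_def by (subst integral_density) (auto simp: ng)
    also have "m * \<dots> = (\<integral>x. g x * indicat_real B (W x) \<partial>N)"
      using 2 by simp
    finally show ?thesis .
  qed
qed

text \<open>The coordinates are treated one at a time by the one-dimensional uniqueness theorem, applied to
  measures with the nonnegative densities \<open>1 + cos (S + c)\<close>, where \<open>S\<close> is a linear combination of the
  remaining coordinates.\<close>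

lemma charfun_unique_box:
  fixes V :: "'i \<Rightarrow> 'a \<Rightarrow> real" and W :: "'i \<Rightarrow> 'b \<Rightarrow> real"
  assumes "finite I" "finite_measure M" "finite_measure N"
    and "\<And>i. i \<in> I \<Longrightarrow> V i \<in> borel_measurable M" "\<And>i. i \<in> I \<Longrightarrow> W i \<in> borel_measurable N"
    and "\<And>\<theta>. (\<integral>x. iexp (\<Sum>i\<in>I. \<theta> i * V i x) \<partial>M) = (\<integral>x. iexp (\<Sum>i\<in>I. \<theta> i * W i x) \<partial>N)"
    and "\<And>i. i \<in> I \<Longrightarrow> B i \<in> sets borel"
  shows "measure M {x\<in>space M. \<forall>i\<in>I. V i x \<in> B i} = measure N {x\<in>space N. \<forall>i\<in>I. W i x \<in> B i}"
  using assms
proof (induction I arbitrary: M N rule: finite_induct)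
  case empty
  have "complex_of_real (measure M (space M)) = of_real (measure N (space N))"
    using empty.prems(5)[of "\<lambda>_. 0"] by simp
  then have "measure M (space M) = measure N (space N)" using of_real_eq_iff by blast
  then show ?case by simp
next
  case (insert j I)
  interpret M: finite_measure M by fact
  interpret N: finite_measure N by fact
  have [measurable]: "V j \<in> borel_measurable M" "W j \<in> borel_measurable N" "B j \<in> sets borel"
    and VI[measurable]: "\<And>i. i \<in> I \<Longrightarrow> V i \<in> borel_measurable M"
    and WI[measurable]: "\<And>i. i \<in> I \<Longrightarrow> W i \<in> borel_measurable N"
    and BI[measurable]: "\<And>i. i \<in> I \<Longrightarrow> B i \<in> sets borel"
    using insert.prems by auto
  let ?S = "\<lambda>\<theta> x. \<Sum>i\<in>I. \<theta> i * V i x" and ?R = "\<lambda>\<theta> x. \<Sum>i\<in>I. \<theta> i * W i x"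
  have [measurable]: "?S \<theta> \<in> borel_measurable M" "?R \<theta> \<in> borel_measurable N" for \<theta>
    by (auto intro!: borel_measurable_sum)
  have norm1: "norm (iexp r) \<le> 1" for r by simp
  have intM[simp]: "integrable M (\<lambda>x. iexp (f x))" if [measurable]: "f \<in> borel_measurable M" for f
    by (rule integrable_bounded_finite_measure[OF insert.prems(1) _ norm1]) simp
  have intN[simp]: "integrable N (\<lambda>x. iexp (f x))" if [measurable]: "f \<in> borel_measurable N" for f
    by (rule integrable_bounded_finite_measure[OF insert.prems(2) _ norm1]) simp
  have eq: "(\<integral>x. iexp (s * V j x + ?S \<theta> x) \<partial>M) = (\<integral>x. iexp (s * W j x + ?R \<theta> x) \<partial>N)" for s \<theta>
  proof -
    have "(\<Sum>i\<in>I. (if i = j then s else \<theta> i) * Z i) = (\<Sum>i\<in>I. \<theta> i * Z i)" for Z :: "'i \<Rightarrow> real"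
      using insert.hyps by (intro sum.cong) auto
    then show ?thesis
      using insert.prems(5)[of "\<lambda>i. if i = j then s else \<theta> i"] insert.hyps by simp
  qed
  \<comment> \<open>A cosine weight in the remaining coordinates only shifts the exponent by plus or
    minus \<open>?S \<theta>\<close>, so the weighted characteristic function is a combination of
    values of the joint one.\<close>
  have expand: "of_real (1 + cos (r + c)) * iexp v =
      iexp v + (iexp c / 2) * iexp (v + r) + (iexp (- c) / 2) * iexp (v - r)" for r c v :: real
    by (simp add: cos_exp_eq cos_of_real[symmetric] distrib_left distrib_right exp_add right_diff_distrib exp_diff exp_minus field_simps)
  have lin: "(\<integral>x. f x + a * g x + b * h x \<partial>Q) = (\<integral>x. f x \<partial>Q) + a * (\<integral>x. g x \<partial>Q) + b * (\<integral>x. h x \<partial>Q)"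
    if "integrable Q f" "integrable Q g" "integrable Q h" for Q :: "'c measure" and f g h :: "'c \<Rightarrow> complex" and a b
    using that by simp
  have cosb: "0 \<le> 1 + cos r" "1 + cos r \<le> 2" for r :: real
    using cos_ge_minus_one[of r] cos_le_one[of r] by linarith+
  have key: "(\<integral>x. (1 + cos (?S \<theta> x + c)) * indicator (B j) (V j x) \<partial>M) =
      (\<integral>x. (1 + cos (?R \<theta> x + c)) * indicator (B j) (W j x) \<partial>N)" for \<theta> c
  proof (rule weighted_charfun_unique[where c = 2])
    fix s
    have m: "?S (\<lambda>i. - \<theta> i) x = - ?S \<theta> x" "?R (\<lambda>i. - \<theta> i) y = - ?R \<theta> y" for x y
      by (simp_all add: sum_negf)
    have "(\<integral>x. of_real (1 + cos (?S \<theta> x + c)) * iexp (s * V j x) \<partial>M) =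
      (\<integral>x. iexp (s * V j x) \<partial>M) + (iexp c / 2) * (\<integral>x. iexp (s * V j x + ?S \<theta> x) \<partial>M)
      + (iexp (-c) / 2) * (\<integral>x. iexp (s * V j x - ?S \<theta> x) \<partial>M)"
      unfolding expand by (intro lin intM) auto
    also have "\<dots> = (\<integral>x. iexp (s * W j x) \<partial>N) + (iexp c / 2) * (\<integral>x. iexp (s * W j x + ?R \<theta> x) \<partial>N)
      + (iexp (-c) / 2) * (\<integral>x. iexp (s * W j x - ?R \<theta> x) \<partial>N)"
      using eq[of s \<theta>] eq[of s "\<lambda>i. - \<theta> i"] eq[of s "\<lambda>i. 0"] unfolding m by simp
    also have "\<dots> = (\<integral>x. of_real (1 + cos (?R \<theta> x + c)) * iexp (s * W j x) \<partial>N)"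
      unfolding expand by (intro lin[symmetric] intN) auto
    finally show "(\<integral>x. of_real (1 + cos (?S \<theta> x + c)) * iexp (s * V j x) \<partial>M) =
      (\<integral>x. of_real (1 + cos (?R \<theta> x + c)) * iexp (s * W j x) \<partial>N)" .
  qed (use insert.prems(1,2) cosb in auto)
  let ?IM = "\<lambda>x. indicator (B j) (V j x) :: real" and ?IN = "\<lambda>x. indicator (B j) (W j x) :: real"
  have bI: "norm (?IM x) \<le> 1" "norm (?IN y) \<le> 1" for x y by (auto simp: indicator_def)
  have iI: "integrable M ?IM" "integrable N ?IN"
    by (auto intro!: integrable_bounded_finite_measure[of _ _ 1] insert.prems simp: bI[simplified])
  have ind: "(\<integral>x. ?IM x \<partial>M) = (\<integral>x. ?IN x \<partial>N)"
    using key[of "\<lambda>_. 0" 0] by simp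
  have ic: "integrable M (\<lambda>x. cos (?S \<theta> x + c) * ?IM x)" "integrable N (\<lambda>x. cos (?R \<theta> x + c) * ?IN x)" for \<theta> c
    by (auto intro!: integrable_bounded_finite_measure[of _ _ 1] insert.prems simp: indicator_def abs_mult)
  have kcos: "(\<integral>x. cos (?S \<theta> x + c) * ?IM x \<partial>M) = (\<integral>x. cos (?R \<theta> x + c) * ?IN x \<partial>N)" for \<theta> c
    using key[of \<theta> c] iI ic ind by (simp add: distrib_right)
  \<comment> \<open>The phases \<open>0\<close> and \<open>- pi/2\<close> turn the cosine identities
    into one for the full exponential, since they give its real and imaginary parts.\<close>
  have ie0: "b *\<^sub>R iexp r = of_real (cos (r + 0) * b) + \<i> * of_real (cos (r + (- pi/2)) * b)" for b r :: real
    by (simp add: complex_eq_iff cis_conv_exp[symmetric] cos_diff)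
  have ie: "?IM x *\<^sub>R iexp (?S \<theta> x) = of_real (cos (?S \<theta> x + 0) * ?IM x) + \<i> * of_real (cos (?S \<theta> x + (- pi/2)) * ?IM x)"
    "?IN y *\<^sub>R iexp (?R \<theta> y) = of_real (cos (?R \<theta> y + 0) * ?IN y) + \<i> * of_real (cos (?R \<theta> y + (-pi/2)) * ?IN y)" for x y \<theta>
    by (rule ie0)+
  have lin2: "(\<integral>x. of_real (f x) + \<i> * of_real (g x) \<partial>Q) = of_real (\<integral>x. f x \<partial>Q) + \<i> * of_real (\<integral>x. g x \<partial>Q)"
    if "integrable Q f" "integrable Q g" for Q :: "'c measure" and f g :: "'c \<Rightarrow> real"
    using that by simp
  \<comment> \<open>Restricting to the event that coordinate \<open>j\<close> lies in
    \<open>B j\<close> leaves measures that in general do not have mass one; hence the induction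
    varies \<open>M\<close> and \<open>N\<close> and assumes only finiteness.\<close>
  define M' where "M' = density M (\<lambda>x. ennreal (?IM x))"
  define N' where "N' = density N (\<lambda>x. ennreal (?IN x))"
  have dM: "emeasure M' A = emeasure M (A \<inter> {x\<in>space M. V j x \<in> B j})" if "A \<in> sets M" for A
    using that unfolding M'_def
    by (subst emeasure_density)
      (auto simp flip: nn_integral_indicator intro!: nn_integral_cong simp: indicator_def)
  have dN: "emeasure N' A = emeasure N (A \<inter> {x\<in>space N. W j x \<in> B j})" if "A \<in> sets N" for A
    using that unfolding N'_def
    by (subst emeasure_density)
      (auto simp flip: nn_integral_indicator intro!: nn_integral_cong simp: indicator_def)
  have "measure M' {x\<in>space M'. \<forall>i\<in>I. V i x \<in> B i} = measure N' {x\<in>space N'. \<forall>i\<in>I. W i x \<in> B i}"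
  proof (rule insert.IH)
    show "finite_measure M'"
      using dM[of "space M"] by (intro finite_measureI) (simp add: M'_def M.emeasure_finite)
    show "finite_measure N'"
      using dN[of "space N"] by (intro finite_measureI) (simp add: N'_def N.emeasure_finite)
    show "(\<integral>x. iexp (?S \<theta> x) \<partial>M') = (\<integral>x. iexp (?R \<theta> x) \<partial>N')" for \<theta>
    proof -
      have "(\<integral>x. iexp (?S \<theta> x) \<partial>M') = (\<integral>x. ?IM x *\<^sub>R iexp (?S \<theta> x) \<partial>M)"
        unfolding M'_def by (subst integral_density) auto
      also have "\<dots> = of_real (\<integral>x. cos (?S \<theta> x + 0) * ?IM x \<partial>M) + \<i> * of_real (\<integral>x. cos (?S \<theta> x + (-pi/2)) * ?IM x \<partial>M)"
        unfolding ie by (rule lin2[OF ic(1) ic(1)])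
      also have "\<dots> = of_real (\<integral>x. cos (?R \<theta> x + 0) * ?IN x \<partial>N) + \<i> * of_real (\<integral>x. cos (?R \<theta> x + (-pi/2)) * ?IN x \<partial>N)"
        unfolding kcos ..
      also have "\<dots> = (\<integral>x. ?IN x *\<^sub>R iexp (?R \<theta> x) \<partial>N)"
        unfolding ie by (rule lin2[OF ic(2) ic(2), symmetric])
      also have "\<dots> = (\<integral>x. iexp (?R \<theta> x) \<partial>N')"
        unfolding N'_def by (subst integral_density) auto
      finally show ?thesis .
    qed
  qed (auto simp: M'_def N'_def)
  moreover have "measure M' {x\<in>space M'. \<forall>i\<in>I. V i x \<in> B i} = measure M {x\<in>space M. \<forall>i\<in>insert j I. V i x \<in> B i}"
  proof -
    have "{x\<in>space M. \<forall>i\<in>I. V i x \<in> B i} \<in> sets M" using insert.hyps by measurable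
    from dM[OF this] show ?thesis
      by (auto simp: measure_def M'_def Int_def intro!: arg_cong[where f = "\<lambda>A. enn2real (emeasure M A)"])
  qed
  moreover have "measure N' {x\<in>space N'. \<forall>i\<in>I. W i x \<in> B i} = measure N {x\<in>space N. \<forall>i\<in>insert j I. W i x \<in> B i}"
  proof -
    have "{x\<in>space N. \<forall>i\<in>I. W i x \<in> B i} \<in> sets N" using insert.hyps by measurable
    from dN[OF this] show ?thesis
      by (auto simp: measure_def N'_def Int_def intro!: arg_cong[where f = "\<lambda>A. enn2real (emeasure N A)"])
  qed
  ultimately show ?case by simp
qed

text \<open>Continuity from above passes from finite boxes to countably many coordinates. Two
  families with separate target sets are the form needed for a pair of independent copies and for a
  remainder paired with a single variable.\<close>

lemma charfun_unique_sequences: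
  fixes V V' :: "nat \<Rightarrow> 'a \<Rightarrow> real" and W W' :: "nat \<Rightarrow> 'b \<Rightarrow> real"
  assumes fm: "finite_measure M" "finite_measure N"
    and [measurable]: "\<And>i. V i \<in> borel_measurable M" "\<And>i. W i \<in> borel_measurable N"
      "\<And>i. V' i \<in> borel_measurable M" "\<And>i. W' i \<in> borel_measurable N"
    and eq: "\<And>n \<theta> \<theta>'. (\<integral>x. iexp ((\<Sum>i<n. \<theta> i * V i x) + (\<Sum>i<n. \<theta>' i * V' i x)) \<partial>M) =
      (\<integral>x. iexp ((\<Sum>i<n. \<theta> i * W i x) + (\<Sum>i<n. \<theta>' i * W' i x)) \<partial>N)"
    and [measurable]: "A \<in> sets borel" "B \<in> sets borel"
  shows "measure M {x\<in>space M. \<forall>i. V i x \<in> A \<and> V' i x \<in> B} =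
    measure N {x\<in>space N. \<forall>i. W i x \<in> A \<and> W' i x \<in> B}"
proof -
  interpret M: finite_measure M by fact
  interpret N: finite_measure N by fact
  let ?A = "\<lambda>n. {x\<in>space M. \<forall>i<n. V i x \<in> A \<and> V' i x \<in> B}"
  let ?B = "\<lambda>n. {x\<in>space N. \<forall>i<n. W i x \<in> A \<and> W' i x \<in> B}"
  have fin: "measure M (?A n) = measure N (?B n)" for n
  proof -
    let ?I = "{..<n} <+> {..<n}"
    have sp: "(\<Sum>i\<in>?I. f i) = (\<Sum>i<n. f (Inl i)) + (\<Sum>i<n. f (Inr i))" for f :: "nat + nat \<Rightarrow> real"
      by (simp add: sum.Plus)
    have "measure M {x\<in>space M. \<forall>i\<in>?I. case_sum V V' i x \<in> case_sum (\<lambda>_. A) (\<lambda>_. B) i} =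
      measure N {x\<in>space N. \<forall>i\<in>?I. case_sum W W' i x \<in> case_sum (\<lambda>_. A) (\<lambda>_. B) i}"
      using fm eq by (intro charfun_unique_box) (auto simp: sp)
    moreover have "{x\<in>space M. \<forall>i\<in>?I. case_sum V V' i x \<in> case_sum (\<lambda>_. A) (\<lambda>_. B) i} = ?A n"
      by (auto simp: Plus_def ball_Un)
    moreover have "{x\<in>space N. \<forall>i\<in>?I. case_sum W W' i x \<in> case_sum (\<lambda>_. A) (\<lambda>_. B) i} = ?B n"
      by (auto simp: Plus_def ball_Un)
    ultimately show ?thesis by simp
  qed
  have "(\<lambda>n. measure M (?A n)) \<longlonglongrightarrow> measure M (\<Inter>n. ?A n)"
    by (rule M.finite_Lim_measure_decseq) (auto simp: decseq_def)
  moreover have "(\<lambda>n. measure N (?B n)) \<longlonglongrightarrow> measure N (\<Inter>n. ?B n)"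
    by (rule N.finite_Lim_measure_decseq) (auto simp: decseq_def)
  ultimately have "measure M (\<Inter>n. ?A n) = measure N (\<Inter>n. ?B n)"
    unfolding fin by (rule LIMSEQ_unique)
  moreover have "(\<Inter>n. ?A n) = {x\<in>space M. \<forall>i. V i x \<in> A \<and> V' i x \<in> B}"
    by auto
  moreover have "(\<Inter>n. ?B n) = {x\<in>space N. \<forall>i. W i x \<in> A \<and> W' i x \<in> B}"
    by auto
  ultimately show ?thesis by simp
qed

section \<open>Gaussian fields and Fernique's theorem\<close>

lemma integrable_mult_square_integrable:
  fixes f g :: "'a \<Rightarrow> real"
  assumes [measurable]: "f \<in> borel_measurable M" "g \<in> borel_measurable M"
    and "integrable M (\<lambda>x. (f x)\<^sup>2)" "integrable M (\<lambda>x. (g x)\<^sup>2)"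
  shows "integrable M (\<lambda>x. f x * g x)"
proof (rule Bochner_Integration.integrable_bound)
  show "integrable M (\<lambda>x. (f x)\<^sup>2 + (g x)\<^sup>2)" using assms by simp
  have "\<bar>a * b\<bar> \<le> a\<^sup>2 + b\<^sup>2" for a b :: real
    using sum_squares_bound[of "\<bar>a\<bar>" "\<bar>b\<bar>"] mult_nonneg_nonneg[of "\<bar>a\<bar>" "\<bar>b\<bar>"]
    unfolding abs_mult power2_abs mult.assoc by linarith
  then show "AE x in M. norm (f x * g x) \<le> norm ((f x)\<^sup>2 + (g x)\<^sup>2)"
    by simp
qed simp

section \<open>Second moments, characteristic functions and tails of centered normal
  variables\<close>

context prob_space
begin

lemma centered_normal_cases:
  assumes "centered_normal_rv M Y"
  obtains "AE x in M. Y x = 0" "integrable M (\<lambda>x. (Y x)\<^sup>2)" "(\<integral>x. (Y x)\<^sup>2 \<partial>M) = 0"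
  | \<sigma> where "\<sigma> > 0" "distributed M lborel Y (normal_density 0 \<sigma>)"
      "integrable M (\<lambda>x. (Y x)\<^sup>2)" "(\<integral>x. (Y x)\<^sup>2 \<partial>M) = \<sigma>\<^sup>2"
proof -
  have [measurable]: "Y \<in> borel_measurable M" using assms by (simp add: centered_normal_rv_def)
  consider "AE x in M. Y x = 0" | \<sigma> where "\<sigma> > 0" "distributed M lborel Y (normal_density 0 \<sigma>)"
    using assms by (auto simp: centered_normal_rv_def)
  then show thesis
  proof cases
    case 1
    have e: "AE x in M. (Y x)\<^sup>2 = (\<lambda>_. 0) x" using 1 by (elim AE_mp) simp
    have "integrable M (\<lambda>x. (Y x)\<^sup>2)" using e by (subst integrable_cong_AE[OF _ _ e]) auto
    moreover have "(\<integral>x. (Y x)\<^sup>2 \<partial>M) = 0" by (subst integral_cong_AE[OF _ _ e]) auto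
    ultimately show thesis using that(1) 1 by blast
  next
    case 2
    have "integrable M (\<lambda>x. (Y x)\<^sup>2) \<longleftrightarrow> integrable lborel (\<lambda>x. normal_density 0 \<sigma> x * x\<^sup>2)"
      by (rule distributed_integrable[OF 2(2), symmetric]) auto
    moreover have "integrable lborel (\<lambda>x. normal_density 0 \<sigma> x * x\<^sup>2)"
      using integrable_normal_moment[OF 2(1), of 0 2] by simp
    moreover have "(\<integral>x. (Y x)\<^sup>2 \<partial>M) = \<sigma>\<^sup>2"
      using normal_distributed_variance[OF 2] normal_distributed_expectation[OF 2] by simp
    ultimately show thesis using that(2)[OF 2] by blast
  qed
qed

lemma centered_normal_square_integrable:
  "centered_normal_rv M Y \<Longrightarrow> integrable M (\<lambda>x. (Y x)\<^sup>2)"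
  by (erule centered_normal_cases)

lemma centered_normal_charfun:
  assumes "centered_normal_rv M Y"
  shows "(\<integral>x. iexp (Y x) \<partial>M) = of_real (exp (- (\<integral>x. (Y x)\<^sup>2 \<partial>M) / 2))"
proof -
  have [measurable]: "Y \<in> borel_measurable M" using assms by (simp add: centered_normal_rv_def)
  from assms show ?thesis
  proof (cases rule: centered_normal_cases)
    case 1
    have "AE x in M. iexp (Y x) = (\<lambda>_. 1) x" using 1(1) by (elim AE_mp) simp
    then have "(\<integral>x. iexp (Y x) \<partial>M) = (\<integral>x. 1 \<partial>M)" by (intro integral_cong_AE) auto
    then show ?thesis using 1(3) by (simp add: prob_space)
  next
    case (2 \<sigma>)
    have "distributed M lborel (\<lambda>x. (Y x - 0) / \<sigma>) std_normal_density"
      using normal_standard_normal_convert[OF 2(1)] 2(2) by blast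
    then have d: "distr M lborel (\<lambda>x. Y x / \<sigma>) = std_normal_distribution"
      by (simp add: distributed_distr_eq_density)
    have "(\<integral>x. iexp (Y x) \<partial>M) = (\<integral>x. iexp (\<sigma> * (Y x / \<sigma>)) \<partial>M)" using 2(1) by simp
    also have "\<dots> = (\<integral>y. iexp (\<sigma> * y) \<partial>distr M lborel (\<lambda>x. Y x / \<sigma>))"
      by (subst integral_distr) auto
    also have "\<dots> = char std_normal_distribution \<sigma>" unfolding d char_def ..
    also have "\<dots> = of_real (exp (- (\<sigma>\<^sup>2) / 2))"
      using fun_cong[OF char_std_normal_distribution, of \<sigma>] by simp
    finally show ?thesis using 2(4) by simp
  qed
qed

text \<open>For \<open>y > r \<ge> 0\<close> one has \<open>y^2 \<ge> r^2 + (y - r)^2\<close>, so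
  beyond \<open>r\<close> the centered density is at most
  \<open>exp (- r^2 / (2 * \<sigma>^2))\<close> times the normal density with mean \<open>r\<close>,
  which integrates to one. Allowing any \<open>v\<close> above the variance includes degenerate
  variables.\<close>

lemma centered_normal_upper_tail:
  assumes "centered_normal_rv M Y" "(\<integral>x. (Y x)\<^sup>2 \<partial>M) \<le> v" "0 < v" "0 \<le> r"
  shows "prob {x\<in>space M. r < Y x} \<le> exp (- r\<^sup>2 / (2 * v))"
proof -
  have [measurable]: "Y \<in> borel_measurable M" using assms by (simp add: centered_normal_rv_def)
  from assms(1) show ?thesis
  proof (cases rule: centered_normal_cases)
    case 1
    have "AE x in M. \<not> r < Y x" using 1(1) by (elim AE_mp) (use assms in auto)
    then have "prob {x\<in>space M. r < Y x} = 0"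
      by (subst prob_Collect_eq_0) auto
    then show ?thesis by simp
  next
    case (2 \<sigma>)
    let ?c = "exp (- r\<^sup>2 / (2 * \<sigma>\<^sup>2))"
    have ps: "prob_space (density lborel (normal_density r \<sigma>))"
      using 2(1) by (rule prob_space_normal_density)
    have le: "normal_density 0 \<sigma> y * indicator {r<..} y \<le> ?c * normal_density r \<sigma> y" for y
    proof (cases "r < y")
      case True
      have "r * r \<le> r * y" using True assms(4) by (intro mult_left_mono) auto
      then have "r\<^sup>2 + (y - r)\<^sup>2 \<le> y\<^sup>2" by (simp add: power2_eq_square algebra_simps)
      then have "- y\<^sup>2 / (2 * \<sigma>\<^sup>2) \<le> (- r\<^sup>2 - (y - r)\<^sup>2) / (2 * \<sigma>\<^sup>2)"
        using 2(1) by (intro divide_right_mono) auto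
      then have "exp (- y\<^sup>2 / (2 * \<sigma>\<^sup>2)) \<le> ?c * exp (- (y - r)\<^sup>2 / (2 * \<sigma>\<^sup>2))"
        unfolding exp_add[symmetric] by (simp add: diff_divide_distrib)
      then have "1 / sqrt (2 * pi * \<sigma>\<^sup>2) * exp (- y\<^sup>2 / (2 * \<sigma>\<^sup>2)) \<le>
          1 / sqrt (2 * pi * \<sigma>\<^sup>2) * (?c * exp (- (y - r)\<^sup>2 / (2 * \<sigma>\<^sup>2)))"
        by (rule mult_left_mono) simp
      then show ?thesis using True by (simp add: normal_density_def mult.left_commute)
    qed simp
    have "emeasure M {x\<in>space M. r < Y x} = (\<integral>\<^sup>+y. ennreal (normal_density 0 \<sigma> y) * indicator {r<..} y \<partial>lborel)"
      using distributed_emeasure[OF 2(2), of "{r<..}"]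
      by (simp add: vimage_def Int_def conj_commute)
    also have "\<dots> = (\<integral>\<^sup>+y. ennreal (normal_density 0 \<sigma> y * indicator {r<..} y) \<partial>lborel)"
      by (intro nn_integral_cong) (auto simp: indicator_def)
    also have "\<dots> \<le> (\<integral>\<^sup>+y. ennreal (?c * normal_density r \<sigma> y) \<partial>lborel)"
      by (intro nn_integral_mono ennreal_leI le)
    also have "\<dots> = ennreal (\<integral>y. ?c * normal_density r \<sigma> y \<partial>lborel)"
      using 2(1) by (intro nn_integral_eq_integral) auto
    also have "\<dots> = ennreal ?c" using 2(1) by simp
    finally have "prob {x\<in>space M. r < Y x} \<le> ?c" by (simp add: emeasure_eq_measure)
    also have "?c \<le> exp (- r\<^sup>2 / (2 * v))"
      using assms(2,3) 2(1,4) by (auto intro!: divide_left_mono)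
    finally show ?thesis .
  qed
qed

text \<open>On \<open>{r<..r+1}\<close> the density is at least its value at \<open>r + 1\<close>,
  and the interval has length one. The shift by one is harmless when \<open>r\<close> grows linearly
  in \<open>u\<close>.\<close>

lemma centered_normal_lower_tail:
  assumes "centered_normal_rv M Y" "(\<integral>x. (Y x)\<^sup>2 \<partial>M) = q" "0 < q" "0 \<le> r"
  shows "exp (- (r + 1)\<^sup>2 / (2 * q)) / sqrt (2 * pi * q) \<le> prob {x\<in>space M. r < Y x}"
proof -
  have [measurable]: "Y \<in> borel_measurable M" using assms by (simp add: centered_normal_rv_def)
  from assms(1) show ?thesis
  proof (cases rule: centered_normal_cases)
    case 1
    then show ?thesis using assms by simp
  next
    case (2 \<sigma>)
    then have q: "q = \<sigma>\<^sup>2" using assms by simp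
    let ?c = "exp (- (r + 1)\<^sup>2 / (2 * q)) / sqrt (2 * pi * q)"
    have le: "ennreal ?c * indicator {r<..r+1} y \<le> ennreal (normal_density 0 \<sigma> y) * indicator {r<..} y" for y
    proof (cases "y \<in> {r<..r+1}")
      case True
      have "y\<^sup>2 \<le> (r+1)\<^sup>2" using True assms(4) by (intro power_mono) auto
      then have "- (r + 1)\<^sup>2 / (2 * \<sigma>\<^sup>2) \<le> - y\<^sup>2 / (2 * \<sigma>\<^sup>2)"
        using 2(1) by (intro divide_right_mono) auto
      then have "?c \<le> normal_density 0 \<sigma> y"
        unfolding q normal_density_def by (auto intro!: divide_right_mono)
      then show ?thesis using True by (auto intro: ennreal_leI)
    qed simp
    have "ennreal ?c = ennreal ?c * emeasure lborel {r<..r+1}" by simp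
    also have "\<dots> = (\<integral>\<^sup>+y. ennreal ?c * indicator {r<..r+1} y \<partial>lborel)"
      by (subst nn_integral_cmult_indicator) auto
    also have "\<dots> \<le> (\<integral>\<^sup>+y. ennreal (normal_density 0 \<sigma> y) * indicator {r<..} y \<partial>lborel)"
      by (intro nn_integral_mono le)
    also have "\<dots> = emeasure M {x\<in>space M. r < Y x}"
      using distributed_emeasure[OF 2(2), of "{r<..}"]
      by (simp add: vimage_def Int_def conj_commute)
    finally show ?thesis by (simp add: emeasure_eq_measure)
  qed
qed

end

section \<open>Linear combinations of the field\<close>

lemma lin_comb_point: "t \<in> T \<Longrightarrow> lin_comb X T (X t)"
  unfolding lin_comb_def
  by (rule exI[of _ 1], rule exI[of _ "\<lambda>_. 1"], rule exI[of _ "\<lambda>_. t"]) auto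

lemma lin_comb_zero: "lin_comb X T (\<lambda>_. 0)"
  unfolding lin_comb_def by (rule exI[of _ 0]) auto

lemma lin_comb_scale: "lin_comb X T Y \<Longrightarrow> lin_comb X T (\<lambda>x. r * Y x)"
  unfolding lin_comb_def
proof (elim exE conjE)
  fix n :: nat and c t
  assume "\<forall>i<n. t i \<in> T" "Y = (\<lambda>\<omega>. \<Sum>i<n. c i * X (t i) \<omega>)"
  then show "\<exists>(n::nat) c t. (\<forall>i<n. t i \<in> T) \<and> (\<lambda>x. r * Y x) = (\<lambda>\<omega>. \<Sum>i<n. c i * X (t i) \<omega>)"
    by (intro exI[of _ n] exI[of _ "\<lambda>i. r * c i"] exI[of _ t]) (auto simp: sum_distrib_left mult.assoc)
qed

lemma sum_lessThan_add:
  fixes f :: "nat \<Rightarrow> 'a::comm_monoid_add"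
  shows "(\<Sum>i<n + m. f i) = (\<Sum>i<n. f i) + (\<Sum>i<m. f (n + i))"
  by (induction m) (auto simp: add.assoc)

lemma lin_comb_add:
  assumes "lin_comb X T Y" "lin_comb X T Z"
  shows "lin_comb X T (\<lambda>x. Y x + Z x)"
proof -
  obtain n :: nat and c t where 1: "\<forall>i<n. t i \<in> T" "Y = (\<lambda>\<omega>. \<Sum>i<n. c i * X (t i) \<omega>)"
    using assms(1) unfolding lin_comb_def by blast
  obtain m :: nat and d s where 2: "\<forall>i<m. s i \<in> T" "Z = (\<lambda>\<omega>. \<Sum>i<m. d i * X (s i) \<omega>)"
    using assms(2) unfolding lin_comb_def by blast
  show ?thesis unfolding lin_comb_def
    using 1 2
    by (intro exI[of _ "n + m"] exI[of _ "\<lambda>i. if i < n then c i else d (i - n)"]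
        exI[of _ "\<lambda>i. if i < n then t i else s (i - n)"]) (auto simp: sum_lessThan_add)
qed

lemma lin_comb_diff:
  "lin_comb X T Y \<Longrightarrow> lin_comb X T Z \<Longrightarrow> lin_comb X T (\<lambda>x. Y x - Z x)"
  using lin_comb_add[of X T Y "\<lambda>x. -1 * Z x"] lin_comb_scale[of X T Z "-1"] by simp

lemma lin_comb_sum:
  assumes "\<And>i. i \<in> I \<Longrightarrow> lin_comb X T (V i)"
  shows "lin_comb X T (\<lambda>x. \<Sum>i\<in>I. \<theta> i * V i x)"
  using assms
  by (induction I rule: infinite_finite_induct) (auto intro!: lin_comb_zero lin_comb_add lin_comb_scale)

lemma lin_comb_mono: "lin_comb X S Y \<Longrightarrow> S \<subseteq> T \<Longrightarrow> lin_comb X T Y"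
  unfolding lin_comb_def by blast

locale gaussian_field = prob_space M for M :: "'a measure" +
  fixes X :: "'d::euclidean_space \<Rightarrow> 'a \<Rightarrow> real" and T :: "'d set"
  assumes gaussian: "centered_gaussian_field M X T"
    and cont: "continuous_paths M X T"
begin

lemma lin_comb_normal: "lin_comb X T Y \<Longrightarrow> centered_normal_rv M Y"
  using gaussian by (simp add: centered_gaussian_field_def)

lemma lin_comb_measurable: "lin_comb X T Y \<Longrightarrow> Y \<in> borel_measurable M"
  using lin_comb_normal by (simp add: centered_normal_rv_def)

lemma lin_comb_square_integrable: "lin_comb X T Y \<Longrightarrow> integrable M (\<lambda>x. (Y x)\<^sup>2)"
  using lin_comb_normal centered_normal_square_integrable by blast

lemma lin_comb_mult_integrable:
  "lin_comb X T Y \<Longrightarrow> lin_comb X T Z \<Longrightarrow> integrable M (\<lambda>x. Y x * Z x)"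
  by (intro integrable_mult_square_integrable lin_comb_measurable lin_comb_square_integrable)

lemma lin_comb_square_expand:
  assumes "lin_comb X T Y" "lin_comb X T Z"
  shows "(\<integral>x. (a * Y x + b * Z x)\<^sup>2 \<partial>M) =
    a\<^sup>2 * (\<integral>x. (Y x)\<^sup>2 \<partial>M) + 2 * a * b * (\<integral>x. Y x * Z x \<partial>M) + b\<^sup>2 * (\<integral>x. (Z x)\<^sup>2 \<partial>M)"
proof -
  have "(a * Y x + b * Z x)\<^sup>2 = a\<^sup>2 * (Y x)\<^sup>2 + 2 * a * b * (Y x * Z x) + b\<^sup>2 * (Z x)\<^sup>2" for x
    by (simp add: power2_eq_square algebra_simps)
  then show ?thesis
    using lin_comb_square_integrable[OF assms(1)] lin_comb_square_integrable[OF assms(2)]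
      lin_comb_mult_integrable[OF assms] by simp
qed

lemma lin_comb_charfun:
  "lin_comb X T Y \<Longrightarrow> (\<integral>x. iexp (Y x) \<partial>M) = of_real (exp (- (\<integral>x. (Y x)\<^sup>2 \<partial>M) / 2))"
  using lin_comb_normal centered_normal_charfun by blast

text \<open>The product space carries two independent copies of the field, and Fubini factorises the
  characteristic function. This is the model with which other joint laws are compared.\<close>

lemma lin_comb_pair_charfun:
  assumes Y: "lin_comb X T Y" and Z: "lin_comb X T Z"
  shows "(\<integral>z. iexp (Y (fst z) + Z (snd z)) \<partial>(M \<Otimes>\<^sub>M M)) =
    of_real (exp (- ((\<integral>x. (Y x)\<^sup>2 \<partial>M) + (\<integral>x. (Z x)\<^sup>2 \<partial>M)) / 2))"
proof -
  interpret P: pair_prob_space M M ..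
  note [measurable] = lin_comb_measurable[OF Y] lin_comb_measurable[OF Z]
  have "integrable (M \<Otimes>\<^sub>M M) (\<lambda>z. iexp (Y (fst z) + Z (snd z)))"
    by (rule integrable_bounded_finite_measure[where c = 1]) (auto intro: P.finite_measure_axioms)
  then have "(\<integral>z. iexp (Y (fst z) + Z (snd z)) \<partial>(M \<Otimes>\<^sub>M M)) = (\<integral>x. (\<integral>y. iexp (Y x + Z y) \<partial>M) \<partial>M)"
    by (subst P.integral_fst'[symmetric]) (auto simp: split_def)
  also have "\<dots> = (\<integral>x. iexp (Y x) * (\<integral>y. iexp (Z y) \<partial>M) \<partial>M)"
    by (simp add: distrib_left exp_add)
  also have "\<dots> = (\<integral>x. iexp (Y x) \<partial>M) * (\<integral>y. iexp (Z y) \<partial>M)" by simp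
  finally show ?thesis
    by (simp add: lin_comb_charfun[OF Y] lin_comb_charfun[OF Z] exp_add[symmetric] exp_of_real[symmetric] add_divide_distrib diff_divide_distrib)
qed

lemma prob_pair_product:
  assumes "A \<in> events" "B \<in> events"
  shows "measure (M \<Otimes>\<^sub>M M) (A \<times> B) = prob A * prob B"
proof -
  interpret P: pair_prob_space M M ..
  show ?thesis using assms
    by (simp add: measure_def emeasure_pair_measure_Times enn2real_mult)
qed

text \<open>If \<open>V'\<close> is an independent copy of \<open>V\<close>, then \<open>(V - V') / sqrt 2\<close> and \<open>(V + V') / sqrt 2\<close> have
  the same joint law as \<open>V\<close> and \<open>V'\<close>.\<close>

lemma fernique_step:
  assumes V: "\<And>i::nat. lin_comb X T (V i)"
  shows "prob {x\<in>space M. \<forall>i. \<bar>V i x\<bar> \<le> s} * prob {x\<in>space M. \<exists>i. t < \<bar>V i x\<bar>} \<le>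
    (prob {x\<in>space M. \<exists>i. (t - s) / sqrt 2 < \<bar>V i x\<bar>})\<^sup>2"
proof -
  interpret P: pair_prob_space M M ..
  note [measurable] = lin_comb_measurable[OF V]
  let ?P = "M \<Otimes>\<^sub>M M"
  let ?U = "\<lambda>i z. (V i (fst z) - V i (snd z)) / sqrt 2"
  let ?U' = "\<lambda>i z. (V i (fst z) + V i (snd z)) / sqrt 2"
  have law: "measure ?P {z\<in>space ?P. \<forall>i. ?U i z \<in> A \<and> ?U' i z \<in> B} =
      prob {x\<in>space M. \<forall>i. V i x \<in> A} * prob {x\<in>space M. \<forall>i. V i x \<in> B}"
    if [measurable]: "A \<in> sets borel" "B \<in> sets borel" for A B
  proof -
    have "measure ?P {z\<in>space ?P. \<forall>i. ?U i z \<in> A \<and> ?U' i z \<in> B} =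
      measure ?P {z\<in>space ?P. \<forall>i. V i (fst z) \<in> A \<and> V i (snd z) \<in> B}"
    proof (rule charfun_unique_sequences)
      fix n and \<theta> \<theta>' :: "nat \<Rightarrow> real"
      define F where "F = (\<lambda>x. \<Sum>i<n. \<theta> i * V i x)"
      define G where "G = (\<lambda>x. \<Sum>i<n. \<theta>' i * V i x)"
      have F: "lin_comb X T F" and G: "lin_comb X T G"
        unfolding F_def G_def by (auto intro!: lin_comb_sum V)
      let ?r = "1 / sqrt 2"
      \<comment> \<open>Sorting by the two coordinates of \<open>z\<close> gives
        \<open>(F + G) / sqrt 2\<close> at the first and \<open>(G - F) / sqrt 2\<close> at the
        second; their mixed terms cancel and the squares add up to those of \<open>F\<close> and
        \<open>G\<close>.\<close>
      have FG: "lin_comb X T (\<lambda>x. ?r * F x + ?r * G x)" "lin_comb X T (\<lambda>x. (-?r) * F x + ?r * G x)"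
        by (intro lin_comb_add lin_comb_scale F G)+
      have "(\<integral>z. iexp ((\<Sum>i<n. \<theta> i * ?U i z) + (\<Sum>i<n. \<theta>' i * ?U' i z)) \<partial>?P) =
         (\<integral>z. iexp ((?r * F (fst z) + ?r * G (fst z)) + ((-?r) * F (snd z) + ?r * G (snd z))) \<partial>?P)"
        by (intro Bochner_Integration.integral_cong refl arg_cong[where f = iexp])
          (simp add: F_def G_def sum_distrib_left sum.distrib[symmetric] sum_subtractf[symmetric] sum_divide_distrib
            field_simps flip: sum_negf)
      also have "\<dots> = of_real (exp (- ((\<integral>x. (F x)\<^sup>2 \<partial>M) + (\<integral>x. (G x)\<^sup>2 \<partial>M)) / 2))"
        unfolding lin_comb_pair_charfun[OF FG] lin_comb_square_expand[OF F G]
        by (simp add: power_divide)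
      also have "\<dots> = (\<integral>z. iexp (F (fst z) + G (snd z)) \<partial>?P)"
        by (rule lin_comb_pair_charfun[OF F G, symmetric])
      finally show "(\<integral>z. iexp ((\<Sum>i<n. \<theta> i * ?U i z) + (\<Sum>i<n. \<theta>' i * ?U' i z)) \<partial>?P) =
         (\<integral>z. iexp ((\<Sum>i<n. \<theta> i * V i (fst z)) + (\<Sum>i<n. \<theta>' i * V i (snd z))) \<partial>?P)"
        by (simp only: F_def G_def)
    qed (auto intro: P.finite_measure_axioms)
    also have "{z\<in>space ?P. \<forall>i. V i (fst z) \<in> A \<and> V i (snd z) \<in> B} =
      {x\<in>space M. \<forall>i. V i x \<in> A} \<times> {x\<in>space M. \<forall>i. V i x \<in> B}"
      by (auto simp: space_pair_measure)
    also have "measure ?P \<dots> = prob {x\<in>space M. \<forall>i. V i x \<in> A} * prob {x\<in>space M. \<forall>i. V i x \<in> B}"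
      by (rule prob_pair_product) measurable
    finally show ?thesis .
  qed
  let ?C = "\<lambda>r. {x\<in>space M. \<forall>i. \<bar>V i x\<bar> \<le> r}" and ?D = "\<lambda>r. {x\<in>space M. \<exists>i. r < \<bar>V i x\<bar>}"
  have C: "{x\<in>space M. \<forall>i. V i x \<in> {-r..r}} = ?C r" for r by (auto simp: abs_le_iff minus_le_iff)
  have D: "prob (?D r) = 1 - prob (?C r)" for r
  proof -
    have "?D r = space M - ?C r" by (auto simp: not_le[symmetric])
    then show ?thesis by (simp add: prob_compl)
  qed
  \<comment> \<open>By \<open>law\<close>, the difference of \<open>?A\<close> and \<open>?B\<close>
    has the probability on the left of the claim. At an index where \<open>?U'\<close> exceeds
    \<open>t\<close> in absolute value, \<open>?U\<close> is still at most \<open>s\<close>, and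
    this forces both coordinates beyond \<open>(t - s) / sqrt 2\<close>.\<close>
  let ?A = "{z\<in>space ?P. \<forall>i. ?U i z \<in> {-s..s} \<and> ?U' i z \<in> UNIV}"
  let ?B = "{z\<in>space ?P. \<forall>i. ?U i z \<in> {-s..s} \<and> ?U' i z \<in> {-t..t}}"
  have "prob (?C s) * prob (?D t) = measure ?P ?A - measure ?P ?B"
    by (subst (1 2) law) (simp_all only: C D, auto simp: prob_space algebra_simps)
  also have "\<dots> = measure ?P (?A - ?B)"
    by (rule P.finite_measure_Diff[symmetric]) (measurable, auto)
  also have "\<dots> \<le> measure ?P (?D ((t - s) / sqrt 2) \<times> ?D ((t - s) / sqrt 2))"
  proof (rule P.finite_measure_mono)
    show "?A - ?B \<subseteq> ?D ((t - s) / sqrt 2) \<times> ?D ((t - s) / sqrt 2)"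
    proof (rule subsetI)
      fix z assume z: "z \<in> ?A - ?B"
      then obtain i where i: "?U i z \<in> {-s..s}" "?U' i z \<notin> {-t..t}" by auto
      define d where "d = V i (fst z) - V i (snd z)"
      define e where "e = V i (fst z) + V i (snd z)"
      have "\<bar>d\<bar> \<le> sqrt 2 * s" using i(1) unfolding d_def[symmetric] by (auto simp: field_simps abs_le_iff)
      moreover have "\<bar>e\<bar> > sqrt 2 * t" using i(2) unfolding e_def[symmetric] by (auto simp: field_simps)
      moreover have "2 * V i (fst z) = e + d" "2 * V i (snd z) = e - d" by (auto simp: d_def e_def)
      moreover have "2 * ((t - s) / sqrt 2) = sqrt 2 * t - sqrt 2 * s"
        by (simp add: real_div_sqrt field_simps)
      ultimately have "(t - s) / sqrt 2 < \<bar>V i (fst z)\<bar>" "(t - s) / sqrt 2 < \<bar>V i (snd z)\<bar>"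
        by linarith+
      then show "z \<in> ?D ((t - s) / sqrt 2) \<times> ?D ((t - s) / sqrt 2)"
        using z by (cases z) (auto simp: space_pair_measure)
    qed
    show "?D ((t - s) / sqrt 2) \<times> ?D ((t - s) / sqrt 2) \<in> P.events" by (intro pair_measureI) measurable
  qed
  also have "\<dots> = (prob (?D ((t - s) / sqrt 2)))\<^sup>2"
    unfolding power2_eq_square by (rule prob_pair_product) measurable
  finally show ?thesis .
qed

text \<open>The step inequality squares a tail probability while the level grows only by a factor of
  about \<open>sqrt 2\<close>, so the tail decays like an exponential of the squared level. A single
  quantile bound at level \<open>s\<close> starts the iteration.\<close>

lemma fernique:
  assumes V: "\<And>i::nat. lin_comb X T (V i)" and s: "0 < s"
    and p: "3 / 4 \<le> prob {x\<in>space M. \<forall>i. \<bar>V i x\<bar> \<le> s}" and t: "4 * s \<le> t"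
  shows "prob {x\<in>space M. \<exists>i. t < \<bar>V i x\<bar>} \<le> exp (- t\<^sup>2 / (32 * s\<^sup>2))"
proof -
  note [measurable] = lin_comb_measurable[OF V]
  define p where "p = prob {x\<in>space M. \<forall>i. \<bar>V i x\<bar> \<le> s}"
  define g where "g r = prob {x\<in>space M. \<exists>i. r < \<bar>V i x\<bar>}" for r
  have p34: "3 / 4 \<le> p" and p1: "p \<le> 1" using p by (auto simp: p_def)
  have step: "p * g r \<le> (g ((r - s) / sqrt 2))\<^sup>2" for r
    unfolding p_def g_def by (rule fernique_step[OF V])
  have g0: "0 \<le> g r" for r by (simp add: g_def)
  have gs: "g s = 1 - p"
  proof -
    have "{x\<in>space M. \<exists>i. s < \<bar>V i x\<bar>} = space M - {x\<in>space M. \<forall>i. \<bar>V i x\<bar> \<le> s}" by (auto simp: not_le[symmetric])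
    then show ?thesis unfolding g_def p_def by (simp add: prob_compl)
  qed
  \<comment> \<open>The levels satisfy \<open>r_(n+1) = sqrt 2 * r_n + s\<close>, a recursion with
    fixed point \<open>- s * (sqrt 2 + 1)\<close>; the coefficient \<open>4\<close> makes the level
    for \<open>n = 0\<close> at least \<open>s\<close>. There
    \<open>1 - p \<le> 1/4 \<le> p / 3\<close>, and the factor \<open>p\<close> in the claim
    reproduces itself under \<open>step\<close>.\<close>
  have main: "g r \<le> p * (1/3) ^ (2 ^ n)" if "s * (4 * sqrt 2 ^ n - (sqrt 2 + 1)) \<le> r" for n r
    using that
  proof (induction n arbitrary: r)
    case 0
    have "sqrt 2 \<le> 2" by (simp add: real_le_lsqrt)
    then have "s * 1 \<le> s * (3 - sqrt 2)" using s by (intro mult_left_mono) auto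
    then have "s \<le> r" using 0 by simp
    then have "g r \<le> g s" unfolding g_def by (intro finite_measure_mono) (auto intro: le_less_trans)
    also have "\<dots> \<le> p * (1/3)" using gs p34 by simp
    finally show ?case by simp
  next
    case (Suc n)
    have "s * (4 * sqrt 2 ^ n - (sqrt 2 + 1)) * sqrt 2 + s = s * (4 * sqrt 2 ^ Suc n - (sqrt 2 + 1))"
      by (simp add: algebra_simps)
    then have "s * (4 * sqrt 2 ^ n - (sqrt 2 + 1)) \<le> (r - s) / sqrt 2"
      using Suc.prems by (simp add: pos_le_divide_eq)
    from Suc.IH[OF this] have "(g ((r - s) / sqrt 2))\<^sup>2 \<le> (p * (1/3) ^ (2 ^ n))\<^sup>2"
      using g0 by (intro power_mono)
    with step[of r] have "p * g r \<le> p * (p * (1/3) ^ (2 ^ Suc n))"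
      by (simp add: power2_eq_square power_mult_distrib power_add[symmetric] mult_2 algebra_simps)
    then show ?case using p34 by simp
  qed
  have "\<exists>n. t\<^sup>2 / (16 * s\<^sup>2) < 2 ^ n" using real_arch_pow[of 2] by simp
  \<comment> \<open>Writing the least such \<open>n\<close> as \<open>k + 1\<close>, the level of
    step \<open>k\<close> is at most \<open>t\<close>, while
    \<open>2 ^ k > t^2 / (32 * s^2)\<close>: the constant 32 is the square of 4, doubled by the
    passage from \<open>n\<close> to \<open>k\<close>. The assumption \<open>4 * s \<le> t\<close>
    excludes \<open>n = 0\<close>.\<close>
  define n where "n = (LEAST n. t\<^sup>2 / (16 * s\<^sup>2) < 2 ^ n)"
  have n1: "t\<^sup>2 / (16 * s\<^sup>2) < 2 ^ n" unfolding n_def by (rule LeastI_ex) fact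
  have "(4 * s)\<^sup>2 \<le> t\<^sup>2" using t s by (intro power_mono) auto
  then have "1 \<le> t\<^sup>2 / (16 * s\<^sup>2)" using s by (simp add: power_mult_distrib)
  with n1 have "n \<noteq> 0" by (cases n) auto
  then obtain k where k: "n = Suc k" using not0_implies_Suc by blast
  then have "2 ^ k \<le> t\<^sup>2 / (16 * s\<^sup>2)" using not_less_Least[of k] unfolding n_def by (metis lessI not_le)
  moreover have sq: "(4 * s * sqrt 2 ^ k)\<^sup>2 = 16 * s\<^sup>2 * 2 ^ k"
  proof -
    have "(sqrt 2 ^ k)\<^sup>2 = (2::real) ^ k" by (simp flip: real_sqrt_power)
    then show ?thesis by (simp add: power_mult_distrib)
  qed
  ultimately have "(4 * s * sqrt 2 ^ k)\<^sup>2 \<le> t\<^sup>2"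
    using s by (simp add: sq pos_le_divide_eq mult.commute)
  then have "4 * s * sqrt 2 ^ k \<le> t" using t s power2_le_imp_le[of "4 * s * sqrt 2 ^ k" t] by linarith
  moreover have "0 \<le> s * (sqrt 2 + 1)" using s by simp
  ultimately have "s * (4 * sqrt 2 ^ k - (sqrt 2 + 1)) \<le> t" by (simp add: algebra_simps)
  from main[OF this] have "g t \<le> 1 * (1/3) ^ (2 ^ k)"
    using p1 by (rule order_trans[OF _ mult_right_mono]) auto
  also have "\<dots> \<le> exp (-1) ^ (2 ^ k)"
    using exp_le by (auto intro!: power_mono simp: exp_minus field_simps)
  also have "\<dots> = exp (- (2 ^ k))" by (simp add: exp_of_nat_mult[symmetric])
  also have "\<dots> \<le> exp (- t\<^sup>2 / (32 * s\<^sup>2))"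
    using n1 k s by (simp add: field_simps)
  finally show ?thesis by (simp add: g_def)
qed

end

section \<open>Convex combinations and duality\<close>

definition convex_comb :: "('d \<Rightarrow> 'a \<Rightarrow> real) \<Rightarrow> 'd set \<Rightarrow> ('a \<Rightarrow> real) \<Rightarrow> bool" where
  "convex_comb X K Y \<longleftrightarrow> (\<exists>(n::nat) c t. (\<forall>i<n. t i \<in> K \<and> 0 \<le> c i) \<and> (\<Sum>i<n. c i) = 1 \<and>
     Y = (\<lambda>\<omega>. \<Sum>i<n. c i * X (t i) \<omega>))"

lemma convex_comb_imp_lin_comb: "convex_comb X K Y \<Longrightarrow> lin_comb X K Y"
  unfolding convex_comb_def lin_comb_def by blast

lemma convex_comb_point: "t \<in> K \<Longrightarrow> convex_comb X K (X t)"
  unfolding convex_comb_def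
  by (rule exI[of _ 1], rule exI[of _ "\<lambda>_. 1"], rule exI[of _ "\<lambda>_. t"]) auto

lemma convex_comb_nonempty:
  assumes "convex_comb X K Y"
  shows "K \<noteq> {}"
proof
  assume "K = {}"
  obtain n :: nat and c t where "\<forall>i<n. t i \<in> K \<and> 0 \<le> c i" "(\<Sum>i<n. c i) = (1::real)"
    using assms unfolding convex_comb_def by blast
  with \<open>K = {}\<close> show False by (cases n) auto
qed

lemma convex_comb_mix:
  assumes "convex_comb X K Y" "t \<in> K" "0 \<le> s" "s \<le> 1"
  shows "convex_comb X K (\<lambda>\<omega>. (1 - s) * Y \<omega> + s * X t \<omega>)"
proof -
  obtain n :: nat and c r where *: "\<forall>i<n. r i \<in> K \<and> 0 \<le> c i" "(\<Sum>i<n. c i) = 1"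
    "Y = (\<lambda>\<omega>. \<Sum>i<n. c i * X (r i) \<omega>)"
    using assms(1) unfolding convex_comb_def by blast
  let ?c = "\<lambda>i. if i < n then (1 - s) * c i else s" and ?r = "\<lambda>i. if i < n then r i else t"
  have 1: "(\<forall>i<Suc n. ?r i \<in> K \<and> 0 \<le> ?c i)" using * assms by auto
  have 2: "(\<Sum>i<Suc n. ?c i) = 1"
    using *(2) by (simp add: sum_distrib_left[symmetric])
  have 3: "(\<lambda>\<omega>. (1 - s) * Y \<omega> + s * X t \<omega>) = (\<lambda>\<omega>. \<Sum>i<Suc n. ?c i * X (?r i) \<omega>)"
    unfolding *(3) by (simp add: sum_distrib_left mult.assoc)
  show ?thesis unfolding convex_comb_def
    by (intro exI[of _ "Suc n"] exI[of _ ?c] exI[of _ ?r] conjI 1 2 3)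
qed

lemma convex_sum_ge:
  fixes c f :: "nat \<Rightarrow> real"
  assumes "\<And>i. i < n \<Longrightarrow> 0 \<le> c i" "(\<Sum>i<n. c i) = 1" "\<And>i. i < n \<Longrightarrow> r \<le> f i"
  shows "r \<le> (\<Sum>i<n. c i * f i)"
proof -
  have "r = (\<Sum>i<n. c i * r)" using assms(2) by (simp add: sum_distrib_right[symmetric])
  also have "\<dots> \<le> (\<Sum>i<n. c i * f i)" using assms by (intro sum_mono mult_left_mono) auto
  finally show ?thesis .
qed

lemma convex_comb_ge:
  assumes "convex_comb X K Y" "\<And>t. t \<in> K \<Longrightarrow> r \<le> X t \<omega>"
  shows "r \<le> Y \<omega>"
proof -
  obtain n :: nat and c t where *: "\<forall>i<n. t i \<in> K \<and> 0 \<le> c i" "(\<Sum>i<n. c i) = 1"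
    "Y = (\<lambda>\<omega>. \<Sum>i<n. c i * X (t i) \<omega>)"
    using assms(1) unfolding convex_comb_def by blast
  show ?thesis unfolding *(3) using * assms(2) by (intro convex_sum_ge) auto
qed

text \<open>Lets an arbitrarily small loss in the rate absorb any constant prefactor.\<close>

lemma eventually_exp_square_ge:
  fixes c C :: real
  assumes "0 < c"
  shows "\<forall>\<^sub>F u in at_top. C \<le> exp (c * u\<^sup>2 / 2)"
proof -
  have "\<forall>\<^sub>F u in at_top. 1 \<le> u \<and> 2 * C / c \<le> (u::real)"
    by (intro eventually_conj eventually_ge_at_top)
  then show ?thesis
  proof (rule eventually_mono)
    fix u :: real assume u: "1 \<le> u \<and> 2 * C / c \<le> u"
    then have "2 * C \<le> c * u" using assms by (simp add: field_simps)
    also have "\<dots> \<le> c * u\<^sup>2" using u assms by (intro mult_left_mono) (auto simp: power2_eq_square)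
    finally have "C \<le> c * u\<^sup>2 / 2" by simp
    also have "\<dots> \<le> exp (c * u\<^sup>2 / 2)" using exp_ge_add_one_self[of "c * u\<^sup>2 / 2"] by linarith
    finally show "C \<le> exp (c * u\<^sup>2 / 2)" .
  qed
qed

lemma exists_dense_sequence:
  fixes K :: "'d::euclidean_space set"
  assumes "K \<noteq> {}"
  obtains d :: "nat \<Rightarrow> 'd" where "range d \<subseteq> K" "K \<subseteq> closure (range d)"
proof -
  obtain C where C: "countable C" "C \<subseteq> K" "K \<subseteq> closure C" by (rule separable)
  have "C \<noteq> {}" using C assms by auto
  then have "range (from_nat_into C) = C" using C(1) by (rule range_from_nat_into)
  then show ?thesis using that[of "from_nat_into C"] C by simp
qed

text \<open>Turns a bound on countably many pairs, which defines an event, into a modulus of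
  continuity on all of \<open>T\<close>. The strict inequality \<open>dist s t < \<delta>\<close>
  passes to the approximating pairs eventually.\<close>

lemma dense_pairs_bound:
  fixes f :: "'d::metric_space \<Rightarrow> real"
  assumes f: "continuous_on T f" and D: "D \<subseteq> T" "T \<subseteq> closure D"
    and le: "\<And>a b. a \<in> D \<Longrightarrow> b \<in> D \<Longrightarrow> dist a b < \<delta> \<Longrightarrow> \<bar>f a - f b\<bar> \<le> r"
    and st: "s \<in> T" "t \<in> T" "dist s t < \<delta>"
  shows "\<bar>f s - f t\<bar> \<le> r"
proof -
  obtain a where a: "\<And>n. a n \<in> D" "a \<longlonglongrightarrow> s" using subsetD[OF D(2) st(1)] unfolding closure_sequential by blast
  obtain b where b: "\<And>n. b n \<in> D" "b \<longlonglongrightarrow> t" using subsetD[OF D(2) st(2)] unfolding closure_sequential by blast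
  have "(\<lambda>n. f (a n)) \<longlonglongrightarrow> f s"
    using a D by (intro continuous_on_tendsto_compose[OF f a(2) st(1)] always_eventually) auto
  moreover have "(\<lambda>n. f (b n)) \<longlonglongrightarrow> f t"
    using b D by (intro continuous_on_tendsto_compose[OF f b(2) st(2)] always_eventually) auto
  ultimately have lim: "(\<lambda>n. \<bar>f (a n) - f (b n)\<bar>) \<longlonglongrightarrow> \<bar>f s - f t\<bar>"
    by (intro tendsto_intros)
  have "(\<lambda>n. dist (a n) (b n)) \<longlonglongrightarrow> dist s t" using a b by (intro tendsto_intros)
  then have "\<forall>\<^sub>F n in sequentially. dist (a n) (b n) < \<delta>" using st(3) by (rule order_tendstoD)
  then have "\<forall>\<^sub>F n in sequentially. \<bar>f (a n) - f (b n)\<bar> \<le> r"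
    by eventually_elim (use le a b in auto)
  then show ?thesis using lim by (intro tendsto_upperbound) auto
qed

text \<open>Continuity from below along integer levels. The conclusion covers every larger
  \<open>r'\<close> because it is later applied at levels that grow with \<open>u\<close>.\<close>

lemma (in prob_space) prob_bounded_sequence:
  assumes [measurable]: "\<And>i::nat. V i \<in> borel_measurable M"
    and b: "\<And>x. x \<in> space M \<Longrightarrow> \<exists>b. \<forall>i. \<bar>V i x\<bar> \<le> (b::real)" and p: "p < 1"
  obtains r where "0 < r" "\<And>r'. r \<le> r' \<Longrightarrow> p \<le> prob {x\<in>space M. \<forall>i. \<bar>V i x\<bar> \<le> r'}"
proof -
  let ?A = "\<lambda>r. {x\<in>space M. \<forall>i. \<bar>V i x\<bar> \<le> r}"
  have "(\<lambda>n. prob (?A (real n))) \<longlonglongrightarrow> prob (\<Union>n. ?A (real n))"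
    by (rule finite_Lim_measure_incseq) (auto simp: incseq_def intro: order_trans)
  moreover have "(\<Union>n. ?A (real n)) = space M"
  proof -
    have "\<exists>n. \<forall>i. \<bar>V i x\<bar> \<le> real n" if "x \<in> space M" for x
      using b[OF that] real_arch_simple by (meson order_trans)
    then show ?thesis by auto
  qed
  ultimately have "(\<lambda>n. prob (?A (real n))) \<longlonglongrightarrow> 1" by (simp add: prob_space)
  then have "\<forall>\<^sub>F n in sequentially. p < prob (?A (real n))" using p by (rule order_tendstoD)
  then have "\<forall>\<^sub>F n in sequentially. p < prob (?A (real n)) \<and> 0 < n"
    using eventually_gt_at_top by (rule eventually_conj)
  then obtain n where n: "p < prob (?A (real n))" "0 < n"
    using eventually_happens'[OF sequentially_bot] by blast
  have "p \<le> prob (?A r')" if "real n \<le> r'" for r'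
  proof -
    have "prob (?A (real n)) \<le> prob (?A r')"
      using that by (intro finite_measure_mono) (auto intro: order_trans)
    then show ?thesis using n by simp
  qed
  then show ?thesis using that[of "real n"] n by simp
qed

section \<open>Bounded variances and near-minimal convex combinations\<close>

context gaussian_field
begin

lemma continuous_sample: "\<omega> \<in> space M \<Longrightarrow> K \<subseteq> T \<Longrightarrow> continuous_on K (\<lambda>t. X t \<omega>)"
  using cont unfolding continuous_paths_def by (auto intro: continuous_on_subset)

text \<open>Path continuity bounds a dense sequence of values by some \<open>r\<close> with
  probability at least \<open>3/4\<close>, and on the same event the bound extends to all of
  \<open>K\<close>. A variable that is so often bounded by \<open>r\<close> has a characteristic
  function bounded away from zero at \<open>1/r\<close>, which for a centered normal variable bounds
  the variance.\<close>

lemma variance_bounded: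
  assumes K: "K \<subseteq> T" "compact K"
  shows "\<exists>B\<ge>0. \<forall>t\<in>K. (\<integral>x. (X t x)\<^sup>2 \<partial>M) \<le> B"
proof (cases "K = {}")
  case True
  then show ?thesis by auto
next
  case False
  obtain d :: "nat \<Rightarrow> 'd" where d: "range d \<subseteq> K" "K \<subseteq> closure (range d)"
    using exists_dense_sequence[OF False] .
  have cl: "closure (range d) = K" using d K(2) by (simp add: closure_minimal compact_imp_closed subset_antisym)
  have lin: "lin_comb X T (X t)" if "t \<in> K" for t using that K(1) by (intro lin_comb_point) auto
  have [measurable]: "X (d i) \<in> borel_measurable M" for i
    using d(1) by (intro lin_comb_measurable lin) auto
  have "\<exists>b. \<forall>i. \<bar>X (d i) x\<bar> \<le> b" if "x \<in> space M" for x
  proof -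
    have "bounded ((\<lambda>t. X t x) ` K)"
      using compact_continuous_image[OF continuous_sample[OF that K(1)] K(2)] by (rule compact_imp_bounded)
    then show ?thesis using d(1) unfolding bounded_iff by (metis (mono_tags, lifting) image_eqI range_subsetD real_norm_def)
  qed
  note bd = this
  obtain r where r0: "0 < r" and r1: "\<And>r'. r \<le> r' \<Longrightarrow> 3/4 \<le> prob {x\<in>space M. \<forall>i. \<bar>X (d i) x\<bar> \<le> r'}"
    by (rule prob_bounded_sequence[of "\<lambda>i. X (d i)" "3/4"]) (use bd in auto)
  have r: "0 < r" "3/4 \<le> prob {x\<in>space M. \<forall>i. \<bar>X (d i) x\<bar> \<le> r}" using r0 r1 by auto
  let ?A = "{x\<in>space M. \<forall>i. \<bar>X (d i) x\<bar> \<le> r}"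
  have "(\<integral>x. (X t x)\<^sup>2 \<partial>M) \<le> 2 * r\<^sup>2 * ln 8" if t: "t \<in> K" for t
  proof -
    note [measurable] = lin_comb_measurable[OF lin[OF t]]
    have iA: "integrable M (\<lambda>x. indicator ?A x :: real)"
      by (rule integrable_real_indicator) (auto simp: emeasure_eq_measure)
    have icos: "integrable M (\<lambda>x. cos (X t x / r))"
      by (rule integrable_bounded_finite_measure[of _ _ 1]) (auto intro: finite_measure_axioms)
    have isin: "integrable M (\<lambda>x. iexp (1 / r * X t x))"
      by (rule integrable_bounded_finite_measure[of _ _ 1]) (auto intro: finite_measure_axioms)
    \<comment> \<open>The cosine is at least \<open>1/2\<close> on \<open>?A\<close>, as
      \<open>1 \<le> pi / 3\<close>, and at least \<open>-1\<close> elsewhere. Its mean is thus at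
      least \<open>3/2 * 3/4 - 1 = 1/8\<close>, the origin of \<open>ln 8\<close>.\<close>
    have le: "3/2 * indicator ?A x - 1 \<le> cos (X t x / r)" if x: "x \<in> space M" for x
    proof (cases "x \<in> ?A")
      case True
      have c: "continuous_on (closure (range d)) (\<lambda>t. \<bar>X t x\<bar>)"
        unfolding cl by (intro continuous_intros continuous_sample[OF x K(1)])
      have "t \<in> closure (range d)" using t cl by blast
      moreover have "\<bar>X y x\<bar> \<le> r" if "y \<in> range d" for y using that True by blast
      ultimately have "\<bar>X t x\<bar> \<le> r" by (rule continuous_le_on_closure[OF c])
      then have "\<bar>X t x / r\<bar> \<le> 1" using r(1) by simp
      then have "\<bar>X t x / r\<bar> \<le> pi / 3" using pi_gt3 by linarith
      then have "cos (pi / 3) \<le> cos \<bar>X t x / r\<bar>" by (intro cos_monotone_0_pi_le) auto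
      then have "1/2 \<le> cos (X t x / r)" unfolding cos_abs_real cos_60 .
      then show ?thesis using True by simp
    next
      case False
      then show ?thesis by simp
    qed
    have "1/8 \<le> 3/2 * prob ?A - 1" using r(2) by simp
    also have "\<dots> = (\<integral>x. 3/2 * indicator ?A x - 1 \<partial>M)"
      using iA by (subst Bochner_Integration.integral_diff) (simp_all add: prob_space)
    also have "\<dots> \<le> (\<integral>x. cos (X t x / r) \<partial>M)"
      using le icos iA by (intro integral_mono) simp_all
    also have "\<dots> = Re (\<integral>x. iexp (1 / r * X t x) \<partial>M)"
      unfolding integral_Re[OF isin, symmetric] by (simp add: Re_exp)
    also have "\<dots> = exp (- ((1/r)\<^sup>2 * (\<integral>x. (X t x)\<^sup>2 \<partial>M)) / 2)"
      using lin_comb_charfun[OF lin_comb_scale[OF lin[OF t], of "1/r"]]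
      by (simp only: Re_complex_of_real power_mult_distrib integral_mult_right_zero)
    finally have "ln (1/8) \<le> ln (exp (- ((1/r)\<^sup>2 * (\<integral>x. (X t x)\<^sup>2 \<partial>M)) / 2))"
      by (subst ln_le_cancel_iff) simp_all
    then have "(1/r)\<^sup>2 * (\<integral>x. (X t x)\<^sup>2 \<partial>M) \<le> 2 * ln 8" by (simp add: ln_div)
    then show ?thesis using r(1) by (simp add: power_divide pos_divide_le_eq mult_ac)
  qed
  moreover have "0 \<le> 2 * r\<^sup>2 * ln 8" by simp
  ultimately show ?thesis by blast
qed

text \<open>A near-minimiser \<open>Y\<close> of the variance over the convex hull of \<open>X ` K\<close> satisfies the
  first-order condition \<open>E (X t * Y) \<ge> E Y\<^sup>2\<close> on \<open>K\<close> up to a small error, so a multiple of it is admissible.\<close>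

lemma admissible_lin_comb_of_convex_bound:
  assumes K: "K \<subseteq> T" "K \<noteq> {}" and v: "0 < v" and q: "1 / v < q"
    and ge: "\<And>Y. convex_comb X K Y \<Longrightarrow> v \<le> (\<integral>x. (Y x)\<^sup>2 \<partial>M)"
    and B: "\<And>t. t \<in> K \<Longrightarrow> (\<integral>x. (X t x)\<^sup>2 \<partial>M) \<le> B"
  shows "\<exists>H. lin_comb X K H \<and> (\<forall>t\<in>K. 1 < w_H M X H t) \<and> (\<integral>x. (H x)\<^sup>2 \<partial>M) \<le> q"
proof -
  define S where "S = {\<integral>x. (Y x)\<^sup>2 \<partial>M | Y. convex_comb X K Y}"
  define m where "m = Inf S"
  obtain t0 where t0: "t0 \<in> K" using K by auto
  have Sne: "S \<noteq> {}" using convex_comb_point[OF t0] unfolding S_def by blast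
  have bdd: "bdd_below S" using ge unfolding S_def by (intro bdd_belowI[of _ v]) auto
  have mle: "m \<le> (\<integral>x. (Y x)\<^sup>2 \<partial>M)" if "convex_comb X K Y" for Y
    unfolding m_def using that bdd by (intro cInf_lower) (auto simp: S_def)
  have vm: "v \<le> m" unfolding m_def using Sne ge by (intro cInf_greatest) (auto simp: S_def)
  then have m0: "0 < m" using v by simp
  have mB: "m \<le> B" using mle[OF convex_comb_point[OF t0]] B[OF t0] by simp
  have "1 / m < q" using vm v q by (meson frac_le le_less_trans order_refl zero_le_one)
  \<comment> \<open>If all covariances with \<open>Y\<close> are at least \<open>m - k\<close>, the
    multiple \<open>1 / (m - 2 * k)\<close> of \<open>Y\<close> is strictly admissible. If moreover
    the variance of \<open>Y\<close> is at most \<open>m + k\<close>, its second moment is at most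
    \<open>(m + k) / (m - 2 * k)^2\<close>, which tends to \<open>1 / m\<close>.\<close>
  have "((\<lambda>k. (m + k) / (m - 2 * k)\<^sup>2) \<longlongrightarrow> (m + 0) / (m - 2 * 0)\<^sup>2) (at_right 0)"
    using m0 by (intro tendsto_intros) auto
  moreover have "(m + 0) / (m - 2 * 0)\<^sup>2 < q" using \<open>1 / m < q\<close> m0 by (simp add: power2_eq_square)
  ultimately have "\<forall>\<^sub>F k in at_right 0. (m + k) / (m - 2 * k)\<^sup>2 < q"
    by (rule order_tendstoD)
  moreover have "\<forall>\<^sub>F k in at_right 0. 0 < k \<and> k < m / 2"
    using eventually_at_right_real[of 0 "m/2"] m0 by auto
  ultimately have "\<forall>\<^sub>F k in at_right 0. (m + k) / (m - 2 * k)\<^sup>2 < q \<and> 0 < k \<and> k < m / 2"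
    by (rule eventually_conj)
  then obtain k where k: "(m + k) / (m - 2 * k)\<^sup>2 < q" "0 < k" "k < m / 2"
    using eventually_happens'[of "at_right (0::real)"] by (auto simp: trivial_limit_at_right_real)
  \<comment> \<open>Moving \<open>Y\<close> by a step \<open>s\<close> towards \<open>X t\<close>
    produces errors of second order in \<open>s\<close>. Choosing \<open>Y\<close> within
    \<open>s^2\<close> of the infimum keeps its own error of that order, so division by
    \<open>s\<close> leaves at most \<open>s * (m + 1 + B) \<le> k\<close>.\<close>
  define s where "s = min (1/2) (k / (m + 1 + B))"
  have s0: "0 < s" "s \<le> 1/2" using k m0 mB by (auto simp: s_def)
  have sk: "s * (m + 1 + B) \<le> k"
  proof -
    have "s \<le> k / (m + 1 + B)" by (simp add: s_def)
    then show ?thesis using m0 mB by (simp add: pos_le_divide_eq)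
  qed
  have s2: "s\<^sup>2 \<le> k"
  proof -
    have "s\<^sup>2 \<le> s * 1" unfolding power2_eq_square using s0 by (intro mult_left_mono) auto
    also have "\<dots> \<le> s * (m + 1 + B)" using s0 m0 mB by (intro mult_left_mono) auto
    finally show ?thesis using sk by simp
  qed
  obtain a where "a \<in> S" "a < m + s\<^sup>2"
    using cInf_lessD[OF Sne, of "m + s\<^sup>2"] s0 unfolding m_def by auto
  then obtain Y where Y: "convex_comb X K Y" "(\<integral>x. (Y x)\<^sup>2 \<partial>M) < m + s\<^sup>2"
    unfolding S_def by blast
  define A where "A = (\<integral>x. (Y x)\<^sup>2 \<partial>M)"
  have lY: "lin_comb X K Y" using Y(1) by (rule convex_comb_imp_lin_comb)
  have lYT: "lin_comb X T Y" using lY K(1) by (rule lin_comb_mono)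
  have w: "m - k \<le> (\<integral>x. Y x * X t x \<partial>M)" if t: "t \<in> K" for t
  proof -
    define w where "w = (\<integral>x. Y x * X t x \<partial>M)"
    define b where "b = (\<integral>x. (X t x)\<^sup>2 \<partial>M)"
    have lX: "lin_comb X T (X t)" using t K(1) by (intro lin_comb_point) auto
    have "m \<le> (1 - s)\<^sup>2 * A + 2 * (1 - s) * s * w + s\<^sup>2 * b"
      using mle[OF convex_comb_mix[OF Y(1) t, of s]] s0
      unfolding lin_comb_square_expand[OF lYT lX] A_def w_def b_def by simp
    also have "(1 - s)\<^sup>2 * A \<le> (1 - s)\<^sup>2 * (m + s\<^sup>2)"
      using Y(2) unfolding A_def by (intro mult_left_mono) auto
    also have "(1 - s)\<^sup>2 * (m + s\<^sup>2) \<le> (1 - s)\<^sup>2 * m + s\<^sup>2"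
    proof -
      have "(1 - s)\<^sup>2 * s\<^sup>2 \<le> 1 * s\<^sup>2" using s0 by (intro mult_right_mono power_le_one) auto
      then show ?thesis by (simp add: distrib_left)
    qed
    also have "s\<^sup>2 * b \<le> s\<^sup>2 * B" using B[OF t] unfolding b_def by (intro mult_left_mono) auto
    finally have "s * (2 * m - s * (m + 1 + B)) \<le> s * (2 * (1 - s) * w)"
      by (simp add: power2_eq_square algebra_simps)
    then have "2 * m - s * (m + 1 + B) \<le> 2 * (1 - s) * w" using s0 by simp
    then have *: "2 * m - k \<le> 2 * (1 - s) * w" using sk by linarith
    then have "0 < 2 * (1 - s) * w" using k m0 by linarith
    then have "0 < w" using s0 by (simp add: zero_less_mult_iff)
    then have "(1 - s) * w \<le> 1 * w" using s0 by (intro mult_right_mono) auto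
    then show ?thesis using * k(2) unfolding w_def by linarith
  qed
  define H where "H = (\<lambda>x. 1 / (m - 2 * k) * Y x)"
  have mk: "0 < m - 2 * k" using k by simp
  have "lin_comb X K H" unfolding H_def by (intro lin_comb_scale lY)
  moreover have "1 < w_H M X H t" if "t \<in> K" for t
  proof -
    have "w_H M X H t = (\<integral>x. 1 / (m - 2 * k) * (Y x * X t x) \<partial>M)"
      unfolding w_H_def H_def by (intro Bochner_Integration.integral_cong) auto
    also have "\<dots> = 1 / (m - 2 * k) * (\<integral>x. Y x * X t x \<partial>M)"
      by (rule integral_mult_right_zero)
    finally show ?thesis using w[OF that] k mk by (simp add: pos_less_divide_eq)
  qed
  moreover have "(\<integral>x. (H x)\<^sup>2 \<partial>M) \<le> q"
  proof -
    have "(\<integral>x. (H x)\<^sup>2 \<partial>M) = (1 / (m - 2 * k))\<^sup>2 * A"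
      unfolding H_def A_def power_mult_distrib by (rule integral_mult_right_zero)
    also have "\<dots> = A / (m - 2 * k)\<^sup>2" by (simp add: power_divide)
    also have "\<dots> \<le> (m + k) / (m - 2 * k)\<^sup>2"
      using Y(2) s2 by (intro divide_right_mono) (auto simp: A_def)
    finally show ?thesis using k(1) by simp
  qed
  ultimately show ?thesis by blast
qed

end

section \<open>Bounds on excursion probabilities\<close>

context gaussian_field
begin

text \<open>Outside the event \<open>D\<close> of a large oscillation, a set may be exchanged for
  any other set that meets the same balls of a finite cover, at the cost of \<open>h * u\<close> in
  the level. One convex combination per pattern of balls then suffices. The family
  \<open>\<K>\<close> is arbitrary, so that truncated path images are covered too.\<close>

lemma excursion_probability_upper:
  assumes T: "compact T" and v: "0 < v" and c: "0 < c" "c * v < 1"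
    and KK: "\<And>K. K \<in> \<K> \<Longrightarrow> K \<subseteq> T"
      "\<And>K. K \<in> \<K> \<Longrightarrow> \<exists>Y. convex_comb X K Y \<and> (\<integral>x. (Y x)\<^sup>2 \<partial>M) \<le> v"
  shows "\<forall>\<^sub>F u in at_top. \<exists>E\<in>events.
    {\<omega>\<in>space M. \<exists>K\<in>\<K>. \<forall>t\<in>K. u < X t \<omega>} \<subseteq> E \<and> prob E \<le> exp (- c * u\<^sup>2 / 2)"
proof (cases "\<K> = {}")
  case True
  then show ?thesis by (intro always_eventually allI bexI[of _ "{}"]) auto
next
  case False
  then have "T \<noteq> {}" using KK convex_comb_nonempty by (metis all_not_in_conv subset_empty)
  then obtain d :: "nat \<Rightarrow> 'd" where d: "range d \<subseteq> T" "T \<subseteq> closure (range d)"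
    by (rule exists_dense_sequence)
  \<comment> \<open>Of the loss \<open>2 * h\<close>, one half pays for the oscillation of the field
    and the other makes the final inequality strict.\<close>
  have "((\<lambda>h. (1 - 2 * h)\<^sup>2) \<longlongrightarrow> (1 - 2 * 0)\<^sup>2) (at_right (0::real))"
    by (intro tendsto_intros)
  then have "\<forall>\<^sub>F h in at_right (0::real). c * v < (1 - 2 * h)\<^sup>2"
    using c by (intro order_tendstoD(1)) auto
  moreover have "\<forall>\<^sub>F h in at_right (0::real). 0 < h \<and> h < 1/2"
    using eventually_at_right_real[of 0 "1/2"] by auto
  ultimately have "\<forall>\<^sub>F h in at_right (0::real). c * v < (1 - 2 * h)\<^sup>2 \<and> 0 < h \<and> h < 1/2"
    by (rule eventually_conj)
  then obtain h :: real where h: "c * v < (1 - 2 * h)\<^sup>2" "0 < h" "h < 1/2"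
    using eventually_happens'[of "at_right (0::real)"] by (auto simp: trivial_limit_at_right_real)
  define c2 where "c2 = (1 - 2 * h)\<^sup>2 / v"
  have c2: "c < c2" using h v by (simp add: c2_def pos_less_divide_eq)
  \<comment> \<open>This level turns the Fernique exponent at \<open>h * u\<close> into
    \<open>- c * u^2\<close>, twice the rate that is required.\<close>
  define s where "s = h / sqrt (32 * c)"
  have s: "0 < s" "h\<^sup>2 / (32 * s\<^sup>2) = c" using h c by (auto simp: s_def power_divide)
  \<comment> \<open>The increments over close pairs of the dense sequence are enumerated as one
    sequence, with \<open>0\<close> for pairs that are not close, because \<open>fernique\<close>
    takes a sequence of linear combinations.\<close>
  let ?V = "\<lambda>n k x. case prod_decode k of (i, j) \<Rightarrow>
     if dist (d i) (d j) < 1 / real (Suc n) then X (d i) x - X (d j) x else 0"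
  have V: "lin_comb X T (?V n k)" for n k
  proof -
    obtain i j where ij: "prod_decode k = (i, j)" by fastforce
    show ?thesis
    proof (cases "dist (d i) (d j) < 1 / real (Suc n)")
      case True
      then have "?V n k = (\<lambda>x. X (d i) x - X (d j) x)" using ij by simp
      then show ?thesis using d(1) by (auto intro!: lin_comb_diff lin_comb_point)
    next
      case False
      then have "?V n k = (\<lambda>x. 0)" using ij by simp
      then show ?thesis using lin_comb_zero by auto
    qed
  qed
  note Vm[measurable] = lin_comb_measurable[OF V]
  \<comment> \<open>Uniform continuity puts every sample into some \<open>?G n\<close>, so a small
    enough scale reaches Fernique's starting probability \<open>3/4\<close> at the prescribed level
    \<open>s\<close>.\<close>
  let ?G = "\<lambda>n. {x\<in>space M. \<forall>k. \<bar>?V n k x\<bar> \<le> s}"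
  have G: "?G n \<in> events" for n by measurable
  have inc: "incseq ?G"
  proof (rule incseq_SucI, rule subsetI)
    fix n x assume x: "x \<in> ?G n"
    have "\<bar>?V (Suc n) k x\<bar> \<le> s" for k
    proof -
      obtain i j where ij: "prod_decode k = (i, j)" by fastforce
      have "\<bar>?V n k x\<bar> \<le> s" using x by blast
      moreover have "1 / real (Suc (Suc n)) \<le> 1 / real (Suc n)" by (intro divide_left_mono) auto
      ultimately show ?thesis using ij s(1) by (auto split: if_splits)
    qed
    then show "x \<in> ?G (Suc n)" using x by blast
  qed
  have un: "(\<Union>n. ?G n) = space M"
  proof -
    have "\<exists>n. \<forall>k. \<bar>?V n k x\<bar> \<le> s" if x: "x \<in> space M" for x
    proof -
      have "uniformly_continuous_on T (\<lambda>t. X t x)"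
        using continuous_sample[OF x] T by (intro compact_uniformly_continuous) auto
      then obtain e where e: "0 < e" "\<And>a b. a \<in> T \<Longrightarrow> b \<in> T \<Longrightarrow> dist b a < e \<Longrightarrow> dist (X b x) (X a x) < s"
        using s(1) unfolding uniformly_continuous_on_def by metis
      obtain n where n: "1 / real (Suc n) < e" using e(1) nat_approx_posE by metis
      have "\<bar>?V n k x\<bar> \<le> s" for k
      proof -
        obtain i j where ij: "prod_decode k = (i, j)" by fastforce
        have "\<bar>X (d i) x - X (d j) x\<bar> \<le> s" if "dist (d i) (d j) < 1 / real (Suc n)"
          using e(2)[of "d j" "d i"] range_subsetD[OF d(1)] n that by (auto simp: dist_real_def)
        then show ?thesis using ij s(1) by auto
      qed
      then show ?thesis by blast
    qed
    then show ?thesis by blast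
  qed
  have "range ?G \<subseteq> events" using G by (rule image_subsetI)
  from finite_Lim_measure_incseq[OF this inc] have "(\<lambda>n. prob (?G n)) \<longlonglongrightarrow> 1"
    unfolding un prob_space .
  then have "\<forall>\<^sub>F n in sequentially. 3/4 < prob (?G n)" by (rule order_tendstoD) simp
  then obtain n where n: "3/4 < prob (?G n)"
    using eventually_happens'[OF sequentially_bot] by blast
  define \<delta> where "\<delta> = 1 / real (Suc n)"
  have \<delta>0: "0 < \<delta>" by (simp add: \<delta>_def)
  have tail: "prob {x\<in>space M. \<exists>k. h * u < \<bar>?V n k x\<bar>} \<le> exp (- c * u\<^sup>2)" if "4 * s \<le> h * u" for u
  proof -
    have "prob {x\<in>space M. \<exists>k. h * u < \<bar>?V n k x\<bar>} \<le> exp (- (h * u)\<^sup>2 / (32 * s\<^sup>2))"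
      using that n s(1) by (intro fernique V) auto
    also have "- (h * u)\<^sup>2 / (32 * s\<^sup>2) = - c * u\<^sup>2"
      unfolding s(2)[symmetric] by (simp add: power_mult_distrib)
    finally show ?thesis .
  qed
  have modulus: "\<bar>X a x - X b x\<bar> \<le> h * u"
    if x: "x \<in> space M" "\<not> (\<exists>k. h * u < \<bar>?V n k x\<bar>)" and ab: "a \<in> T" "b \<in> T" "dist a b < \<delta>" for a b x u
  proof (rule dense_pairs_bound[OF continuous_sample[OF x(1) order_refl] d _ ab])
    fix y z assume yz: "y \<in> range d" "z \<in> range d" "dist y z < \<delta>"
    then obtain i j where ij: "y = d i" "z = d j" by blast
    have "\<bar>?V n (prod_encode (i, j)) x\<bar> \<le> h * u" using x(2) by (meson not_less)
    then show "\<bar>X y x - X z x\<bar> \<le> h * u" using yz(3) ij by (simp add: \<delta>_def)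
  qed
  obtain N where N: "finite N" "T \<subseteq> (\<Union>y\<in>N. ball y (\<delta>/2))"
    using T \<delta>0 unfolding compact_eq_totally_bounded by (meson half_gt_zero)
  \<comment> \<open>The pattern of balls met by \<open>K\<close> is a subset of the finite set
    \<open>N\<close>, so only finitely many patterns occur; \<open>rep\<close> picks one member of
    \<open>\<K>\<close> for each.\<close>
  define trace where "trace K = {y\<in>N. K \<inter> ball y (\<delta>/2) \<noteq> {}}" for K
  define rep where "rep = inv_into \<K> trace"
  define J where "J = trace ` \<K>"
  have finJ: "finite J" unfolding J_def
    by (rule finite_subset[of _ "Pow N"]) (use N(1) in \<open>auto simp: trace_def\<close>)
  have rep: "rep \<sigma> \<in> \<K>" "trace (rep \<sigma>) = \<sigma>" if "\<sigma> \<in> J" for \<sigma>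
    using that unfolding rep_def J_def by (rule inv_into_into, rule f_inv_into_f)
  define Y where "Y \<sigma> = (SOME Y. convex_comb X (rep \<sigma>) Y \<and> (\<integral>x. (Y x)\<^sup>2 \<partial>M) \<le> v)" for \<sigma>
  have Y: "convex_comb X (rep \<sigma>) (Y \<sigma>)" "(\<integral>x. (Y \<sigma> x)\<^sup>2 \<partial>M) \<le> v" if "\<sigma> \<in> J" for \<sigma>
    using someI_ex[OF KK(2)[OF rep(1)[OF that]]] unfolding Y_def by auto
  have lY: "lin_comb X T (Y \<sigma>)" if "\<sigma> \<in> J" for \<sigma>
    using convex_comb_imp_lin_comb[OF Y(1)[OF that]] KK(1)[OF rep(1)[OF that]] by (rule lin_comb_mono)
  note Ym[measurable] = lin_comb_measurable[OF lY]
  define C where "C = 1 + real (card J)"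
  \<comment> \<open>The rates \<open>2 * c\<close> of the oscillation and \<open>c2\<close> of the
    representatives are both at least \<open>c + \<kappa>\<close>; the spare \<open>\<kappa>\<close>
    absorbs the number \<open>C\<close> of summands.\<close>
  define \<kappa> where "\<kappa> = min c (c2 - c)"
  have \<kappa>: "0 < \<kappa>" "\<kappa> \<le> c" "\<kappa> \<le> c2 - c" using c c2 by (auto simp: \<kappa>_def)
  from \<kappa>(1) have "\<forall>\<^sub>F u in at_top. C \<le> exp (\<kappa> * u\<^sup>2 / 2)" by (rule eventually_exp_square_ge)
  moreover have "\<forall>\<^sub>F u in at_top. 0 < u \<and> 4 * s / h \<le> (u::real)"
    by (intro eventually_conj eventually_ge_at_top eventually_gt_at_top)
  ultimately show ?thesis
  proof eventually_elim
    case (elim u)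
    then have u: "0 < u" "4 * s \<le> h * u" using h by (auto simp: field_simps)
    define D where "D = {x\<in>space M. \<exists>k. h * u < \<bar>?V n k x\<bar>}"
    define E where "E \<sigma> = {x\<in>space M. (1 - 2 * h) * u < Y \<sigma> x}" for \<sigma>
    have E0: "D \<in> events" unfolding D_def by measurable
    have E: "E \<sigma> \<in> events" if "\<sigma> \<in> J" for \<sigma> using Ym[OF that] unfolding E_def by measurable
    have ev: "D \<union> (\<Union>\<sigma>\<in>J. E \<sigma>) \<in> events" using E0 E finJ by (intro sets.Un sets.finite_UN)
    have sub: "{\<omega>\<in>space M. \<exists>K\<in>\<K>. \<forall>t\<in>K. u < X t \<omega>} \<subseteq> D \<union> (\<Union>\<sigma>\<in>J. E \<sigma>)"
    proof (rule subsetI)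
      fix x assume "x \<in> {\<omega>\<in>space M. \<exists>K\<in>\<K>. \<forall>t\<in>K. u < X t \<omega>}"
      then obtain K where K: "K \<in> \<K>" "\<forall>t\<in>K. u < X t x" and x: "x \<in> space M" by blast
      show "x \<in> D \<union> (\<Union>\<sigma>\<in>J. E \<sigma>)"
      proof (cases "x \<in> D")
        case False
        then have nE: "\<not> (\<exists>k. h * u < \<bar>?V n k x\<bar>)" using x by (auto simp: D_def)
        have J: "trace K \<in> J" using K(1) by (simp add: J_def)
        have "(1 - h) * u \<le> X t x" if t: "t \<in> rep (trace K)" for t
        proof -
          have tT: "t \<in> T" using KK(1)[OF rep(1)[OF J]] t by blast
          then obtain y where y: "y \<in> N" "t \<in> ball y (\<delta>/2)" using N(2) by blast
          then have "y \<in> trace (rep (trace K))" using t by (auto simp: trace_def)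
          then have "y \<in> trace K" using rep(2)[OF J] by simp
          then obtain k where k: "k \<in> K" "k \<in> ball y (\<delta>/2)" by (auto simp: trace_def)
          have "dist k t < \<delta>" using y(2) k(2) dist_triangle_half_r[of y k \<delta> t] by (simp add: dist_commute)
          then have "\<bar>X k x - X t x\<bar> \<le> h * u"
            using modulus[OF x nE] k(1) KK(1)[OF K(1)] tT by blast
          moreover have "u < X k x" using K(2) k(1) by blast
          ultimately show ?thesis by (simp add: algebra_simps)
        qed
        then have "(1 - h) * u \<le> Y (trace K) x" using convex_comb_ge[OF Y(1)[OF J]] by blast
        moreover have "(1 - 2 * h) * u < (1 - h) * u" using u h by simp
        ultimately have "(1 - 2 * h) * u < Y (trace K) x" by linarith
        then show ?thesis using J x by (auto simp: E_def)
      qed blast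
    qed
    have "prob (D \<union> (\<Union>\<sigma>\<in>J. E \<sigma>)) \<le> prob D + prob (\<Union>\<sigma>\<in>J. E \<sigma>)"
      using E0 E finJ by (intro measure_Un_le sets.finite_UN)
    also have "prob (\<Union>\<sigma>\<in>J. E \<sigma>) \<le> (\<Sum>\<sigma>\<in>J. prob (E \<sigma>))"
      using E finJ by (intro measure_UNION_le)
    also have "\<dots> \<le> (\<Sum>\<sigma>\<in>J. exp (- c2 * u\<^sup>2 / 2))"
    proof (rule sum_mono)
      fix \<sigma> assume \<sigma>: "\<sigma> \<in> J"
      have "prob (E \<sigma>) \<le> exp (- ((1 - 2 * h) * u)\<^sup>2 / (2 * v))"
        unfolding E_def
        using lin_comb_normal[OF lY[OF \<sigma>]] Y(2)[OF \<sigma>] v u h by (intro centered_normal_upper_tail) auto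
      also have "- ((1 - 2 * h) * u)\<^sup>2 / (2 * v) = - c2 * u\<^sup>2 / 2"
        by (simp add: c2_def power_mult_distrib)
      finally show "prob (E \<sigma>) \<le> exp (- c2 * u\<^sup>2 / 2)" .
    qed
    also have "prob D \<le> exp (- c * u\<^sup>2)" unfolding D_def using tail[OF u(2)] .
    also have "exp (- c * u\<^sup>2) \<le> exp (- (c + \<kappa>) * u\<^sup>2 / 2)"
    proof -
      have "(c + \<kappa>) * u\<^sup>2 \<le> (2 * c) * u\<^sup>2" using \<kappa> by (intro mult_right_mono) auto
      then show ?thesis by (simp add: algebra_simps)
    qed
    also have "(\<Sum>\<sigma>\<in>J. exp (- c2 * u\<^sup>2 / 2)) \<le> real (card J) * exp (- (c + \<kappa>) * u\<^sup>2 / 2)"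
    proof -
      have "(c + \<kappa>) * u\<^sup>2 \<le> c2 * u\<^sup>2" using \<kappa> by (intro mult_right_mono) auto
      then have "exp (- c2 * u\<^sup>2 / 2) \<le> exp (- (c + \<kappa>) * u\<^sup>2 / 2)" by (simp add: algebra_simps)
      then show ?thesis by (simp add: mult_left_mono)
    qed
    finally have "prob (D \<union> (\<Union>\<sigma>\<in>J. E \<sigma>)) \<le> C * exp (- (c + \<kappa>) * u\<^sup>2 / 2)"
      by (simp add: C_def algebra_simps)
    also have "\<dots> \<le> exp (\<kappa> * u\<^sup>2 / 2) * exp (- (c + \<kappa>) * u\<^sup>2 / 2)"
      using elim by (intro mult_right_mono) auto
    also have "\<dots> = exp (- c * u\<^sup>2 / 2)"
      by (simp add: exp_add[symmetric] field_simps)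
    finally have "prob (D \<union> (\<Union>\<sigma>\<in>J. E \<sigma>)) \<le> exp (- c * u\<^sup>2 / 2)" .
    with ev sub show ?case by blast
  qed
qed

text \<open>Uncorrelated jointly Gaussian variables are independent: without mixed terms, the joint
  characteristic function is that of \<open>Z\<close> and \<open>H\<close> on the two factors of the
  product space. \<open>H\<close> enters as a constant sequence, so its coefficients collapse to
  their sum \<open>e\<close>.\<close>

lemma prob_joint_uncorrelated:
  assumes Z: "\<And>i::nat. lin_comb X T (Z i)" and H: "lin_comb X T H"
    and unc: "\<And>i. (\<integral>x. Z i x * H x \<partial>M) = 0"
    and [measurable]: "A \<in> sets borel" "B \<in> sets borel"
  shows "prob {x\<in>space M. \<forall>i. Z i x \<in> A \<and> H x \<in> B} =
    prob {x\<in>space M. \<forall>i. Z i x \<in> A} * prob {x\<in>space M. H x \<in> B}"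
proof -
  interpret P: pair_prob_space M M ..
  let ?P = "M \<Otimes>\<^sub>M M"
  note [measurable] = lin_comb_measurable[OF Z] lin_comb_measurable[OF H]
  have "prob {x\<in>space M. \<forall>i. Z i x \<in> A \<and> H x \<in> B} =
    measure ?P {z\<in>space ?P. \<forall>i. Z i (fst z) \<in> A \<and> H (snd z) \<in> B}"
  proof (rule charfun_unique_sequences)
    fix n and \<theta> \<theta>' :: "nat \<Rightarrow> real"
    define F where "F = (\<lambda>x. \<Sum>i<n. \<theta> i * Z i x)"
    define e where "e = (\<Sum>i<n. \<theta>' i)"
    have F: "lin_comb X T F" unfolding F_def by (intro lin_comb_sum Z)
    have "(\<integral>x. F x * H x \<partial>M) = (\<integral>x. (\<Sum>i<n. \<theta> i * (Z i x * H x)) \<partial>M)"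
      by (simp add: F_def sum_distrib_right mult.assoc)
    also have "\<dots> = (\<Sum>i<n. \<theta> i * (\<integral>x. Z i x * H x \<partial>M))"
      using lin_comb_mult_integrable[OF Z H] by (subst Bochner_Integration.integral_sum) auto
    finally have FH: "(\<integral>x. F x * H x \<partial>M) = 0" by (simp add: unc)
    have "(\<integral>x. iexp ((\<Sum>i<n. \<theta> i * Z i x) + (\<Sum>i<n. \<theta>' i * H x)) \<partial>M) = (\<integral>x. iexp (1 * F x + e * H x) \<partial>M)"
      by (simp only: F_def e_def sum_distrib_right mult_1)
    also have "\<dots> = of_real (exp (- (\<integral>x. (1 * F x + e * H x)\<^sup>2 \<partial>M) / 2))"
      by (intro lin_comb_charfun lin_comb_add lin_comb_scale F H)
    also have "\<dots> = of_real (exp (- ((\<integral>x. (F x)\<^sup>2 \<partial>M) + (\<integral>x. (e * H x)\<^sup>2 \<partial>M)) / 2))"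
      unfolding lin_comb_square_expand[OF F H] FH by (simp add: power_mult_distrib)
    also have "\<dots> = (\<integral>z. iexp (F (fst z) + e * H (snd z)) \<partial>?P)"
      by (rule lin_comb_pair_charfun[OF F lin_comb_scale[OF H], symmetric])
    finally show "(\<integral>x. iexp ((\<Sum>i<n. \<theta> i * Z i x) + (\<Sum>i<n. \<theta>' i * H x)) \<partial>M) =
       (\<integral>z. iexp ((\<Sum>i<n. \<theta> i * Z i (fst z)) + (\<Sum>i<n. \<theta>' i * H (snd z))) \<partial>?P)"
      by (simp only: F_def e_def sum_distrib_right)
  qed (auto intro: P.finite_measure_axioms finite_measure_axioms)
  also have "{z\<in>space ?P. \<forall>i. Z i (fst z) \<in> A \<and> H (snd z) \<in> B} =
      {x\<in>space M. \<forall>i. Z i x \<in> A} \<times> {x\<in>space M. H x \<in> B}"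
    by (auto simp: space_pair_measure)
  also have "measure ?P \<dots> = prob {x\<in>space M. \<forall>i. Z i x \<in> A} * prob {x\<in>space M. H x \<in> B}"
    by (rule prob_pair_product) measurable
  finally show ?thesis .
qed

text \<open>The decomposition along \<open>H\<close> is made only on a dense sequence, where the
  remainders form a countable family; continuity carries the bound to \<open>K\<close>. For large
  \<open>u\<close> the remainders stay above \<open>- h * u\<close> with probability at least
  \<open>1/2\<close>, so \<open>H\<close> alone sets the rate.\<close>

lemma excursion_probability_lower:
  assumes K: "K \<subseteq> T" "compact K" "K \<noteq> {}" and H: "lin_comb X T H"
    and w: "\<And>t. t \<in> K \<Longrightarrow> 1 \<le> w_H M X H t" and q: "(\<integral>x. (H x)\<^sup>2 \<partial>M) < q"
  shows "\<forall>\<^sub>F u in at_top. \<exists>E\<in>events.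
    E \<subseteq> {\<omega>\<in>space M. \<forall>t\<in>K. u < X t \<omega>} \<and> exp (- q * u\<^sup>2 / 2) \<le> prob E"
proof -
  define p where "p = (\<integral>x. (H x)\<^sup>2 \<partial>M)"
  note Hm[measurable] = lin_comb_measurable[OF H]
  note iH = lin_comb_square_integrable[OF H]
  obtain d :: "nat \<Rightarrow> 'd" where d: "range d \<subseteq> K" "K \<subseteq> closure (range d)"
    using exists_dense_sequence[OF K(3)] .
  have cl: "closure (range d) = K" using d K(2) by (simp add: closure_minimal compact_imp_closed subset_antisym)
  have dT: "d i \<in> T" and dK: "d i \<in> K" for i using d(1) K(1) by auto
  have lX: "lin_comb X T (X (d i))" for i using dT by (rule lin_comb_point)
  \<comment> \<open>If \<open>H\<close> vanished almost surely, so would \<open>w_H\<close>, against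
    the lower bound \<open>1\<close> on the nonempty \<open>K\<close>.\<close>
  have p0: "0 < p"
  proof (rule ccontr)
    assume "\<not> 0 < p"
    moreover have "0 \<le> p" unfolding p_def by simp
    ultimately have "AE x in M. (H x)\<^sup>2 = 0"
      using integral_nonneg_eq_0_iff_AE[OF iH] unfolding p_def by simp
    then have "AE x in M. X (d 0) x * H x = 0" by (elim AE_mp) simp
    then have "w_H M X H (d 0) = 0" unfolding w_H_def by (rule integral_eq_zero_AE)
    then show False using w[OF dK[of 0]] by simp
  qed
  \<comment> \<open>The three units of \<open>h\<close> pay for the remainder, for strictness after
    passing to the closure, and for the unit interval in the lower tail estimate.\<close>
  have "((\<lambda>h. p * (1 + 3 * h)\<^sup>2) \<longlongrightarrow> p * (1 + 3 * 0)\<^sup>2) (at_right (0::real))"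
    by (intro tendsto_intros)
  then have "\<forall>\<^sub>F h in at_right (0::real). p * (1 + 3 * h)\<^sup>2 < q"
    using q by (intro order_tendstoD(2)) (auto simp: p_def)
  moreover have "\<forall>\<^sub>F h in at_right (0::real). 0 < h \<and> h < 1"
    using eventually_at_right_real[of 0 1] by auto
  ultimately have "\<forall>\<^sub>F h in at_right (0::real). p * (1 + 3 * h)\<^sup>2 < q \<and> 0 < h \<and> h < 1"
    by (rule eventually_conj)
  then obtain h :: real where h: "p * (1 + 3 * h)\<^sup>2 < q" "0 < h"
    using eventually_happens'[of "at_right (0::real)"] by (auto simp: trivial_limit_at_right_real)
  define w where "w i = w_H M X H (d i)" for i
  define Z where "Z i = (\<lambda>x. X (d i) x - w i / p * H x)" for i
  have w1: "1 \<le> w i" for i unfolding w_def using dK by (rule assms)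
  have lZ: "lin_comb X T (Z i)" for i unfolding Z_def by (intro lin_comb_diff lin_comb_scale lX H)
  have unc: "(\<integral>x. Z i x * H x \<partial>M) = 0" for i
  proof -
    have "(\<integral>x. Z i x * H x \<partial>M) = (\<integral>x. X (d i) x * H x - w i / p * (H x)\<^sup>2 \<partial>M)"
      by (intro Bochner_Integration.integral_cong) (auto simp: Z_def algebra_simps power2_eq_square)
    also have "\<dots> = w i - w i / p * p"
      using lin_comb_mult_integrable[OF lX H] iH
      by (subst Bochner_Integration.integral_diff) (auto simp: w_def w_H_def p_def)
    finally show ?thesis using p0 by simp
  qed
  obtain B where B: "0 \<le> B" "\<And>t. t \<in> K \<Longrightarrow> (\<integral>x. (X t x)\<^sup>2 \<partial>M) \<le> B"
    using variance_bounded[OF K(1,2)] by blast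
  \<comment> \<open>A bound uniform in \<open>i\<close> is what makes the remainders
    \<open>Z i x\<close> bounded for each fixed \<open>x\<close>.\<close>
  have wB: "w i \<le> B + p" for i
  proof -
    have "X (d i) x * H x \<le> (X (d i) x)\<^sup>2 + (H x)\<^sup>2" for x
      using sum_squares_bound[of "X (d i) x" "H x"] zero_le_power2[of "X (d i) x"] zero_le_power2[of "H x"]
      unfolding mult.assoc by linarith
    then have "w i \<le> (\<integral>x. (X (d i) x)\<^sup>2 + (H x)\<^sup>2 \<partial>M)"
      unfolding w_def w_H_def
      using lin_comb_mult_integrable[OF lX H] lin_comb_square_integrable[OF lX] iH
      by (intro integral_mono) auto
    also have "\<dots> = (\<integral>x. (X (d i) x)\<^sup>2 \<partial>M) + p"
      using lin_comb_square_integrable[OF lX] iH by (simp add: p_def)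
    finally show ?thesis using B(2)[OF dK[of i]] by simp
  qed
  have bd: "\<exists>b. \<forall>i. \<bar>Z i x\<bar> \<le> b" if x: "x \<in> space M" for x
  proof -
    have "bounded ((\<lambda>t. X t x) ` K)"
      using compact_continuous_image[OF continuous_sample[OF x K(1)] K(2)] by (rule compact_imp_bounded)
    then obtain b where b: "\<And>t. t \<in> K \<Longrightarrow> \<bar>X t x\<bar> \<le> b" unfolding bounded_iff by auto
    have "\<bar>Z i x\<bar> \<le> b + (B + p) / p * \<bar>H x\<bar>" for i
    proof -
      have "\<bar>Z i x\<bar> \<le> \<bar>X (d i) x\<bar> + \<bar>w i / p * H x\<bar>" unfolding Z_def by (rule abs_triangle_ineq4)
      also have "\<bar>w i / p * H x\<bar> = w i / p * \<bar>H x\<bar>" using w1[of i] p0 by (simp add: abs_mult)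
      also have "\<dots> \<le> (B + p) / p * \<bar>H x\<bar>"
        using wB[of i] p0 by (intro mult_right_mono divide_right_mono) auto
      finally show ?thesis using b[OF dK[of i]] by simp
    qed
    then show ?thesis by blast
  qed
  note Zm[measurable] = lin_comb_measurable[OF lZ]
  obtain r where r: "0 < r" "\<And>r'. r \<le> r' \<Longrightarrow> 1/2 \<le> prob {x\<in>space M. \<forall>i. \<bar>Z i x\<bar> \<le> r'}"
    by (rule prob_bounded_sequence[of Z "1/2"]) (use bd in auto)
  let ?c = "q - p * (1 + 3 * h)\<^sup>2"
  have "0 < ?c" using h by simp
  then have "\<forall>\<^sub>F u in at_top. 2 * sqrt (2 * pi * p) \<le> exp (?c * u\<^sup>2 / 2)" by (rule eventually_exp_square_ge)
  moreover have "\<forall>\<^sub>F u in at_top. 0 < u \<and> r / h \<le> u \<and> 1 / (p * h) \<le> (u::real)"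
    by (intro eventually_conj eventually_ge_at_top eventually_gt_at_top)
  ultimately show ?thesis
  proof eventually_elim
    case (elim u)
    then have u: "0 < u" "r \<le> h * u" "1 \<le> p * h * u" using h p0 by (auto simp: field_simps)
    let ?r = "p * (1 + 2 * h) * u"
    let ?E = "{x\<in>space M. \<forall>i. Z i x \<in> {- (h * u)..} \<and> H x \<in> {?r<..}}"
    have Eev: "?E \<in> events" by measurable
    have sub: "?E \<subseteq> {\<omega>\<in>space M. \<forall>t\<in>K. u < X t \<omega>}"
    proof (rule subsetI)
      fix x assume xE: "x \<in> ?E"
      then have x: "x \<in> space M" by blast
      have ge: "(1 + h) * u \<le> X (d i) x" for i
      proof -
        have zi: "- (h * u) \<le> Z i x" and hx: "?r < H x" using xE by auto
        have "1 * ((1 + 2 * h) * u) \<le> w i * ((1 + 2 * h) * u)"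
          using w1[of i] u h by (intro mult_right_mono) auto
        also have "\<dots> = w i / p * ?r" using p0 by simp
        also have "\<dots> \<le> w i / p * H x" using hx w1[of i] p0 by (intro mult_left_mono) auto
        finally show ?thesis using zi by (simp add: Z_def algebra_simps)
      qed
      have c: "continuous_on (closure (range d)) (\<lambda>t. X t x)"
        unfolding cl by (rule continuous_sample[OF x K(1)])
      have "u < X t x" if t: "t \<in> K" for t
      proof -
        have "(1 + h) * u \<le> X t x"
          by (rule continuous_ge_on_closure[OF c]) (use t cl ge in auto)
        moreover have "1 * u < (1 + h) * u" using h u by (intro mult_strict_right_mono) auto
        ultimately show ?thesis by simp
      qed
      then show "x \<in> {\<omega>\<in>space M. \<forall>t\<in>K. u < X t \<omega>}" using x by blast
    qed
    have "prob ?E = prob {x\<in>space M. \<forall>i. Z i x \<in> {- (h * u)..}} * prob {x\<in>space M. H x \<in> {?r<..}}"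
      by (rule prob_joint_uncorrelated[OF lZ H unc]) auto
    moreover have "1/2 \<le> prob {x\<in>space M. \<forall>i. Z i x \<in> {- (h * u)..}}"
    proof -
      have "1/2 \<le> prob {x\<in>space M. \<forall>i. \<bar>Z i x\<bar> \<le> h * u}" using u(2) by (rule r(2))
      also have "\<dots> \<le> prob {x\<in>space M. \<forall>i. Z i x \<in> {- (h * u)..}}"
        by (intro finite_measure_mono) (auto simp: abs_le_iff minus_le_iff)
      finally show ?thesis .
    qed
    moreover have "exp (- (p * (1 + 3 * h)\<^sup>2) * u\<^sup>2 / 2) / sqrt (2 * pi * p) \<le> prob {x\<in>space M. H x \<in> {?r<..}}"
    proof -
      have "(?r + 1)\<^sup>2 \<le> (p * (1 + 3 * h) * u)\<^sup>2"
        using u h p0 by (intro power_mono) (auto simp: algebra_simps)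
      then have "(?r + 1)\<^sup>2 / (2 * p) \<le> (p * (1 + 3 * h) * u)\<^sup>2 / (2 * p)"
        using p0 by (intro divide_right_mono) auto
      also have "\<dots> = p * (1 + 3 * h)\<^sup>2 * u\<^sup>2 / 2"
        using p0 by (simp add: power_mult_distrib power2_eq_square)
      finally have "exp (- (p * (1 + 3 * h)\<^sup>2) * u\<^sup>2 / 2) / sqrt (2 * pi * p) \<le>
          exp (- (?r + 1)\<^sup>2 / (2 * p)) / sqrt (2 * pi * p)"
        using p0 by (intro divide_right_mono) auto
      also have "\<dots> \<le> prob {x\<in>space M. ?r < H x}"
        using lin_comb_normal[OF H] p0 u h by (intro centered_normal_lower_tail) (auto simp: p_def)
      finally show ?thesis by simp
    qed
    ultimately have "1/2 * (exp (- (p * (1 + 3 * h)\<^sup>2) * u\<^sup>2 / 2) / sqrt (2 * pi * p)) \<le> prob ?E"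
      using p0 by (simp only:) (intro mult_mono, auto)
    moreover have "exp (- q * u\<^sup>2 / 2) \<le> 1/2 * (exp (- (p * (1 + 3 * h)\<^sup>2) * u\<^sup>2 / 2) / sqrt (2 * pi * p))"
    proof -
      have "exp (- q * u\<^sup>2 / 2) * (2 * sqrt (2 * pi * p)) \<le> exp (- q * u\<^sup>2 / 2) * exp (?c * u\<^sup>2 / 2)"
        using elim by (intro mult_left_mono) auto
      also have "\<dots> = exp (- (p * (1 + 3 * h)\<^sup>2) * u\<^sup>2 / 2)"
        unfolding exp_add[symmetric] by (simp add: field_simps)
      finally show ?thesis using p0 by (simp add: field_simps)
    qed
    ultimately have "exp (- q * u\<^sup>2 / 2) \<le> prob ?E" by linarith
    with Eev sub show ?case by blast
  qed
qed

end

section \<open>Logarithmic rates\<close>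

lemma outer_prob_le: "A \<subseteq> E \<Longrightarrow> E \<in> sets M \<Longrightarrow> outer_prob M A \<le> measure M E"
  unfolding outer_prob_def by (intro cINF_lower bdd_belowI[of _ 0]) auto

lemma outer_prob_ge:
  assumes "finite_measure M" "E \<subseteq> A" "E \<in> sets M" "A \<subseteq> space M"
  shows "measure M E \<le> outer_prob M A"
proof -
  interpret finite_measure M by fact
  show ?thesis unfolding outer_prob_def
    using assms by (intro cINF_greatest finite_measure_mono) auto
qed

text \<open>Bounds are required only at rates strictly on either side of \<open>C\<close>. For
  \<open>C = 0\<close> the upper family is empty and \<open>\<Psi> u \<le> 1\<close> takes its
  place; for infinite \<open>C\<close> the lower family is empty, in accordance with the limit
  \<open>-\<infinity>\<close>.\<close>

lemma eln_rate_tendsto: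
  fixes C :: ereal
  assumes C: "0 \<le> C" and le1: "\<And>u. \<Psi> u \<le> 1"
    and up: "\<And>c. 0 < c \<Longrightarrow> ereal c < C \<Longrightarrow> \<forall>\<^sub>F u in at_top. \<Psi> u \<le> exp (- c * u\<^sup>2 / 2)"
    and lo: "\<And>q. C < ereal q \<Longrightarrow> \<forall>\<^sub>F u in at_top. exp (- q * u\<^sup>2 / 2) \<le> \<Psi> u"
  shows "((\<lambda>u. eln (\<Psi> u) / ereal (u\<^sup>2)) \<longlongrightarrow> - C / 2) at_top"
proof (rule order_tendstoI)
  fix y assume "y < - C / 2"
  then obtain z where z: "y < ereal z" "ereal z < - C / 2" using ereal_dense2 by blast
  have "C < ereal (- 2 * z)" using z(2) C by (cases C) auto
  from lo[OF this] eventually_gt_at_top[of 0]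
  show "\<forall>\<^sub>F u in at_top. y < eln (\<Psi> u) / ereal (u\<^sup>2)"
  proof eventually_elim
    case (elim u)
    then have e: "exp (z * u\<^sup>2) \<le> \<Psi> u" by simp
    then have pos: "0 < \<Psi> u" using exp_gt_zero[of "z * u\<^sup>2"] by linarith
    have "ln (exp (z * u\<^sup>2)) \<le> ln (\<Psi> u)" using e pos by (subst ln_le_cancel_iff) auto
    then have "z \<le> ln (\<Psi> u) / u\<^sup>2" using elim by (simp add: pos_le_divide_eq)
    moreover have "eln (\<Psi> u) / ereal (u\<^sup>2) = ereal (ln (\<Psi> u) / u\<^sup>2)"
      using pos elim by (simp add: eln_def)
    ultimately show ?case using z(1) by (metis ereal_less_eq(3) less_le_trans)
  qed
next
  fix y assume "- C / 2 < y"
  then obtain z where z: "- C / 2 < ereal z" "ereal z < y" using ereal_dense2 by blast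
  have zC: "ereal (- 2 * z) < C" using z(1) C by (cases C) auto
  have "\<forall>\<^sub>F u in at_top. \<Psi> u \<le> exp (z * u\<^sup>2)"
  proof (cases "0 < - 2 * z")
    case True
    from up[OF this zC] show ?thesis by simp
  next
    case False
    then have "1 \<le> exp (z * u\<^sup>2)" for u :: real by simp
    then show ?thesis using le1 order_trans by (intro always_eventually allI) blast
  qed
  then show "\<forall>\<^sub>F u in at_top. eln (\<Psi> u) / ereal (u\<^sup>2) < y"
    using eventually_gt_at_top[of 0]
  proof eventually_elim
    case (elim u)
    have "eln (\<Psi> u) / ereal (u\<^sup>2) \<le> ereal z"
    proof (cases "0 < \<Psi> u")
      case True
      then have "ln (\<Psi> u) \<le> ln (exp (z * u\<^sup>2))" using elim by (subst ln_le_cancel_iff) auto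
      then have "ln (\<Psi> u) / u\<^sup>2 \<le> z" using elim by (simp add: pos_divide_le_eq)
      then show ?thesis using True elim by (simp add: eln_def)
    next
      case False
      then show ?thesis using elim by (simp add: eln_def)
    qed
    then show ?case using z(2) by (rule le_less_trans)
  qed
qed

lemma gaussian_field_subset:
  assumes "centered_gaussian_field M X T" "continuous_paths M X T" "prob_space M" "S \<subseteq> T"
  shows "gaussian_field M X S"
proof -
  interpret prob_space M by fact
  show ?thesis
  proof
    show "centered_gaussian_field M X S"
      using assms(1,4) lin_comb_mono unfolding centered_gaussian_field_def by (meson subsetD)
    show "continuous_paths M X S"
      using assms(2,4) unfolding continuous_paths_def by (auto intro: continuous_on_subset)
  qed
qed

context gaussian_field
begin

text \<open>Converts the variance bound supplied by an admissible \<open>H\<close> or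
  \<open>h\<close> into a finite linear combination, to which the Gaussian lower bound applies. The
  midpoint of \<open>q\<close> and \<open>q'\<close> leaves strict room on both sides.\<close>

lemma excursion_probability_lower_of_convex_bound:
  assumes K: "K \<subseteq> T" "compact K" "K \<noteq> {}" and q: "0 < q" "q < q'"
    and ge: "\<And>Y. convex_comb X K Y \<Longrightarrow> 1 / q \<le> (\<integral>x. (Y x)\<^sup>2 \<partial>M)"
  shows "\<forall>\<^sub>F u in at_top. \<exists>E\<in>events.
    E \<subseteq> {\<omega>\<in>space M. \<forall>t\<in>K. u < X t \<omega>} \<and> exp (- q' * u\<^sup>2 / 2) \<le> prob E"
proof -
  obtain B where B: "\<And>t. t \<in> K \<Longrightarrow> (\<integral>x. (X t x)\<^sup>2 \<partial>M) \<le> B"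
    using variance_bounded[OF K(1,2)] by blast
  have "\<exists>H. lin_comb X K H \<and> (\<forall>t\<in>K. 1 < w_H M X H t) \<and> (\<integral>x. (H x)\<^sup>2 \<partial>M) \<le> (q + q') / 2"
    using q by (intro admissible_lin_comb_of_convex_bound[OF K(1,3) _ _ ge B]) auto
  then obtain H where H: "lin_comb X K H" "\<forall>t\<in>K. 1 < w_H M X H t" "(\<integral>x. (H x)\<^sup>2 \<partial>M) \<le> (q + q') / 2"
    by blast
  show ?thesis
    using K q H lin_comb_mono[OF H(1) K(1)] by (intro excursion_probability_lower[of K H]) (auto intro: less_imp_le)
qed

text \<open>Contrapositive of \<open>admissible_lin_comb_of_convex_bound\<close>: were all variances
  above \<open>1 / c\<close>, some admissible \<open>H\<close> would have second moment at most
  \<open>(c + c') / 2 < c'\<close>.\<close>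

lemma convex_comb_of_admissible_bound:
  assumes K: "K \<subseteq> T" "compact T" "K \<noteq> {}" and c: "0 < c" "c < c'"
    and ge: "\<And>H. lin_comb X K H \<Longrightarrow> \<forall>t\<in>K. 1 < w_H M X H t \<Longrightarrow> c' \<le> (\<integral>x. (H x)\<^sup>2 \<partial>M)"
  shows "\<exists>Y. convex_comb X K Y \<and> (\<integral>x. (Y x)\<^sup>2 \<partial>M) \<le> 1 / c"
proof (rule ccontr)
  assume neg: "\<not> ?thesis"
  obtain B where B: "\<And>t. t \<in> T \<Longrightarrow> (\<integral>x. (X t x)\<^sup>2 \<partial>M) \<le> B"
    using variance_bounded[OF order_refl K(2)] by blast
  have "\<exists>H. lin_comb X K H \<and> (\<forall>t\<in>K. 1 < w_H M X H t) \<and> (\<integral>x. (H x)\<^sup>2 \<partial>M) \<le> (c + c') / 2"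
  proof (rule admissible_lin_comb_of_convex_bound[OF K(1,3)])
    show "1 / c \<le> (\<integral>x. (Y x)\<^sup>2 \<partial>M)" if "convex_comb X K Y" for Y
      using neg that by (meson linear)
  qed (use c B K(1) in auto)
  then show False using ge c by fastforce
qed

text \<open>Averaging \<open>w_H > 1\<close> with the convex weights gives
  \<open>E (Y * H) \<ge> 1\<close>; then expand \<open>E (Y - H / q)^2 \<ge> 0\<close>. Only square
  integrability of \<open>H\<close> enters, so elements of the closure are covered without their
  laws.\<close>

lemma convex_comb_pairing_bound:
  assumes K: "K \<subseteq> T" and H: "H \<in> borel_measurable M" "integrable M (\<lambda>x. (H x)\<^sup>2)"
    and w: "\<And>t. t \<in> K \<Longrightarrow> 1 < w_H M X H t" and q: "(\<integral>x. (H x)\<^sup>2 \<partial>M) \<le> q" "0 < q"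
    and Y: "convex_comb X K Y"
  shows "1 / q \<le> (\<integral>x. (Y x)\<^sup>2 \<partial>M)"
proof -
  have lY: "lin_comb X T Y" using convex_comb_imp_lin_comb[OF Y] K by (rule lin_comb_mono)
  note iY = lin_comb_square_integrable[OF lY]
  have iYH: "integrable M (\<lambda>x. Y x * H x)"
    using lin_comb_measurable[OF lY] iY H by (intro integrable_mult_square_integrable)
  obtain n :: nat and c t where *: "\<forall>i<n. t i \<in> K \<and> 0 \<le> c i" "(\<Sum>i<n. c i) = 1"
    "Y = (\<lambda>\<omega>. \<Sum>i<n. c i * X (t i) \<omega>)"
    using Y unfolding convex_comb_def by blast
  have iXH: "integrable M (\<lambda>x. X (t i) x * H x)" if "i < n" for i
  proof -
    have l: "lin_comb X T (X (t i))" using that * K by (intro lin_comb_point) auto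
    show ?thesis
      by (rule integrable_mult_square_integrable[OF lin_comb_measurable[OF l] H(1) lin_comb_square_integrable[OF l] H(2)])
  qed
  have "(\<integral>x. Y x * H x \<partial>M) = (\<integral>x. (\<Sum>i<n. c i * (X (t i) x * H x)) \<partial>M)"
    by (simp add: *(3) sum_distrib_right mult.assoc)
  also have "\<dots> = (\<Sum>i<n. c i * w_H M X H (t i))"
    using iXH by (subst Bochner_Integration.integral_sum) (auto simp: w_H_def)
  also have "1 \<le> \<dots>" using * w by (intro convex_sum_ge) (auto intro: less_imp_le)
  finally have YH: "1 \<le> (\<integral>x. Y x * H x \<partial>M)" .
  have "0 \<le> (\<integral>x. (Y x - 1 / q * H x)\<^sup>2 \<partial>M)" by simp
  also have "\<dots> = (\<integral>x. (Y x)\<^sup>2 - 2 / q * (Y x * H x) + (1 / q)\<^sup>2 * (H x)\<^sup>2 \<partial>M)"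
    by (intro Bochner_Integration.integral_cong) (auto simp: power2_eq_square algebra_simps)
  also have "\<dots> = (\<integral>x. (Y x)\<^sup>2 \<partial>M) - 2 / q * (\<integral>x. Y x * H x \<partial>M) + (1 / q)\<^sup>2 * (\<integral>x. (H x)\<^sup>2 \<partial>M)"
    using iY iYH H by simp
  finally have 0: "0 \<le> \<dots>" .
  have 1: "2 / q * 1 \<le> 2 / q * (\<integral>x. Y x * H x \<partial>M)" using YH q by (intro mult_left_mono) auto
  have "(1 / q)\<^sup>2 * (\<integral>x. (H x)\<^sup>2 \<partial>M) \<le> (1 / q)\<^sup>2 * q" using q by (intro mult_left_mono) auto
  also have "\<dots> = 1 / q" using q(2) by (simp add: power2_eq_square)
  finally show ?thesis using 0 1 by (simp only: mult_1_right)
qed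

end

section \<open>Compact parameter sets\<close>

lemma excursion_rate_compact:
  fixes X :: "'d::euclidean_space \<Rightarrow> 'a \<Rightarrow> real"
  assumes M: "prob_space M" and T: "compact T" and X: "centered_gaussian_field M X T" "continuous_paths M X T"
  shows "((\<lambda>u. eln (Psi_ab M X T a b u) / ereal (u\<^sup>2)) \<longlongrightarrow> - C_ab M X T a b / 2) at_top"
proof -
  interpret gaussian_field M X T using X M by (intro gaussian_field_subset[of M X T T]) auto
  define \<K> where "\<K> = {\<xi> ` {0..1} | \<xi>. \<xi> \<in> paths_from_to a b \<and> (\<forall>v\<in>{0..1}. \<xi> v \<in> T)}"
  define S where "S u = {\<omega>\<in>space M. \<exists>K\<in>\<K>. \<forall>t\<in>K. u < X t \<omega>}" for u
  have Psi: "Psi_ab M X T a b u = outer_prob M (S u)" for u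
  proof -
    have "(\<exists>\<xi>\<in>paths_from_to a b. \<forall>v\<in>{0..1}. \<xi> v \<in> T \<and> u < X (\<xi> v) \<omega>) \<longleftrightarrow> (\<exists>K\<in>\<K>. \<forall>t\<in>K. u < X t \<omega>)" for \<omega>
    proof
      assume "\<exists>\<xi>\<in>paths_from_to a b. \<forall>v\<in>{0..1}. \<xi> v \<in> T \<and> u < X (\<xi> v) \<omega>"
      then obtain \<xi> where \<xi>: "\<xi> \<in> paths_from_to a b" "\<forall>v\<in>{0..1}. \<xi> v \<in> T \<and> u < X (\<xi> v) \<omega>" by blast
      show "\<exists>K\<in>\<K>. \<forall>t\<in>K. u < X t \<omega>"
        by (rule bexI[of _ "\<xi> ` {0..1}"]) (use \<xi> in \<open>auto simp: \<K>_def\<close>)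
    next
      assume "\<exists>K\<in>\<K>. \<forall>t\<in>K. u < X t \<omega>"
      then obtain \<xi> where "\<xi> \<in> paths_from_to a b" "\<forall>v\<in>{0..1}. \<xi> v \<in> T" "\<forall>t\<in>\<xi> ` {0..1}. u < X t \<omega>"
        unfolding \<K>_def by blast
      then show "\<exists>\<xi>\<in>paths_from_to a b. \<forall>v\<in>{0..1}. \<xi> v \<in> T \<and> u < X (\<xi> v) \<omega>" by blast
    qed
    then show ?thesis by (simp add: Psi_ab_def S_def)
  qed
  show ?thesis
  proof (rule eln_rate_tendsto)
    show "0 \<le> C_ab M X T a b" unfolding C_ab_def by (rule Inf_greatest) auto
    show "Psi_ab M X T a b u \<le> 1" for u
      unfolding Psi using outer_prob_le[of "S u" "space M" M] by (auto simp: S_def prob_space)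
  next
    fix c assume c: "0 < c" "ereal c < C_ab M X T a b"
    \<comment> \<open>Two intermediate rates are inserted because the duality step and the
      probability bound each need a strict gap: \<open>c2\<close> stays below the infimum and
      \<open>c1\<close> lies between \<open>c\<close> and \<open>c2\<close>.\<close>
    obtain c2 where c2: "ereal c < ereal c2" "ereal c2 < C_ab M X T a b" using ereal_dense2[OF c(2)] by blast
    define c1 where "c1 = (c + c2) / 2"
    have c1: "0 < c1" "c < c1" "c1 < c2" using c c2 by (auto simp: c1_def)
    have "\<forall>\<^sub>F u in at_top. \<exists>E\<in>events. S u \<subseteq> E \<and> prob E \<le> exp (- c * u\<^sup>2 / 2)"
      unfolding S_def
    proof (rule excursion_probability_upper[OF T, of "1 / c1"])
      fix K assume "K \<in> \<K>"
      then obtain \<xi> where \<xi>: "K = \<xi> ` {0..1}" "\<xi> \<in> paths_from_to a b" "\<forall>v\<in>{0..1}. \<xi> v \<in> T"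
        unfolding \<K>_def by blast
      then show KT: "K \<subseteq> T" by blast
      show "\<exists>Y. convex_comb X K Y \<and> (\<integral>x. (Y x)\<^sup>2 \<partial>M) \<le> 1 / c1"
      proof (rule convex_comb_of_admissible_bound[OF KT T _ c1(1,3)])
        show "K \<noteq> {}" using \<xi> by simp
        fix H assume H: "lin_comb X K H" "\<forall>t\<in>K. 1 < w_H M X H t"
        have lH: "lin_comb X T H" using H(1) KT by (rule lin_comb_mono)
        have "in_L M X T H" unfolding in_L_def
          using lin_comb_measurable[OF lH] lin_comb_square_integrable[OF lH] lH
          by (auto intro!: exI[of _ "\<lambda>_. H"])
        then have "C_ab M X T a b \<le> ereal (\<integral>x. (H x)\<^sup>2 \<partial>M)"
          unfolding C_ab_def using \<xi> H(2) by (intro Inf_lower) blast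
        with c2(2) have "ereal c2 < ereal (\<integral>x. (H x)\<^sup>2 \<partial>M)" by (rule less_le_trans)
        then show "c2 \<le> (\<integral>x. (H x)\<^sup>2 \<partial>M)" by simp
      qed
    qed (use c c1 in auto)
    then show "\<forall>\<^sub>F u in at_top. Psi_ab M X T a b u \<le> exp (- c * u\<^sup>2 / 2)"
      unfolding Psi by (rule eventually_mono) (meson order_trans outer_prob_le)
  next
    fix q assume "C_ab M X T a b < ereal q"
    then obtain H \<xi> where H: "in_L M X T H" "(\<integral>x. (H x)\<^sup>2 \<partial>M) < q"
      and \<xi>: "\<xi> \<in> paths_from_to a b" "\<And>v. v \<in> {0..1} \<Longrightarrow> \<xi> v \<in> T \<and> 1 < w_H M X H (\<xi> v)"
      unfolding C_ab_def Inf_less_iff by auto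
    define K where "K = \<xi> ` {0..1}"
    have K: "K \<subseteq> T" "compact K" "K \<noteq> {}" "K \<in> \<K>"
      using \<xi> unfolding K_def \<K>_def
      by (auto intro!: compact_continuous_image simp: paths_from_to_def)
    \<comment> \<open>The midpoint is below \<open>q\<close> and is positive without first showing
      \<open>E H^2 > 0\<close>, as the reciprocal bound requires.\<close>
    define q1 where "q1 = ((\<integral>x. (H x)\<^sup>2 \<partial>M) + q) / 2"
    have "0 \<le> (\<integral>x. (H x)\<^sup>2 \<partial>M)" by simp
    then have "0 < q" using H(2) by linarith
    then have q1: "(\<integral>x. (H x)\<^sup>2 \<partial>M) \<le> q1" "0 < q1" "q1 < q"
      using H(2) by (auto simp: q1_def intro: add_nonneg_pos)
    have "\<forall>\<^sub>F u in at_top. \<exists>E\<in>events. E \<subseteq> {\<omega>\<in>space M. \<forall>t\<in>K. u < X t \<omega>} \<and> exp (- q * u\<^sup>2 / 2) \<le> prob E"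
    proof (rule excursion_probability_lower_of_convex_bound[OF K(1-3) q1(2,3)])
      show "1 / q1 \<le> (\<integral>x. (Y x)\<^sup>2 \<partial>M)" if "convex_comb X K Y" for Y
        using H(1) \<xi>(2) q1 that
        by (intro convex_comb_pairing_bound[OF K(1), of H]) (auto simp: in_L_def K_def)
    qed
    then show "\<forall>\<^sub>F u in at_top. exp (- q * u\<^sup>2 / 2) \<le> Psi_ab M X T a b u"
    proof (rule eventually_mono)
      fix u assume "\<exists>E\<in>events. E \<subseteq> {\<omega>\<in>space M. \<forall>t\<in>K. u < X t \<omega>} \<and> exp (- q * u\<^sup>2 / 2) \<le> prob E"
      then obtain E where E: "E \<in> events" "E \<subseteq> {\<omega>\<in>space M. \<forall>t\<in>K. u < X t \<omega>}" "exp (- q * u\<^sup>2 / 2) \<le> prob E"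
        by blast
      have "E \<subseteq> S u" using E(2) K(4) unfolding S_def by blast
      then have "prob E \<le> outer_prob M (S u)"
        using E(1) by (intro outer_prob_ge finite_measure_axioms) (auto simp: S_def)
      then show "exp (- q * u\<^sup>2 / 2) \<le> Psi_ab M X T a b u" unfolding Psi using E(3) by simp
    qed
  qed
qed

section \<open>Spectral representation of a stationary field\<close>

definition trig_sum :: "nat \<Rightarrow> (nat \<Rightarrow> real) \<Rightarrow> (nat \<Rightarrow> 'd::euclidean_space) \<Rightarrow> 'd \<Rightarrow> complex" where
  "trig_sum n c t x = (\<Sum>i<n. of_real (c i) * cis (t i \<bullet> x))"

lemma Re_trig_sum: "Re (trig_sum n c t x) = (\<Sum>i<n. c i * cos (t i \<bullet> x))"
  and Im_trig_sum: "Im (trig_sum n c t x) = (\<Sum>i<n. c i * sin (t i \<bullet> x))"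
  by (simp_all add: trig_sum_def)

lemma borel_measurable_trig_sum [measurable]: "trig_sum n c t \<in> borel_measurable borel"
  unfolding trig_sum_def[abs_def] cis_conv_exp
  by (intro borel_measurable_continuous_onI continuous_intros)

lemma norm_trig_sum_le: "norm (trig_sum n c t x) \<le> (\<Sum>i<n. \<bar>c i\<bar>)"
  unfolding trig_sum_def by (rule order_trans[OF norm_sum]) (simp add: norm_mult)

locale spectral_field = gaussian_field M X UNIV for M :: "'a measure" and X :: "'d::euclidean_space \<Rightarrow> 'a \<Rightarrow> real" +
  fixes F :: "'d measure"
  assumes stationary: "stationary_cov M X" and spectral: "spectral_measure_of M X F"
begin

lemma finite_F: "finite_measure F" and sets_F[measurable_cong]: "sets F = sets borel"
  using spectral by (auto simp: spectral_measure_of_def)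

text \<open>Symmetry of the product reverses the argument in \<open>stationary_cov\<close>, which
  then matches \<open>cis (s \<bullet> x) * cnj (cis (t \<bullet> x))\<close>.\<close>

lemma cov_eq: "(\<integral>x. X s x * X t x \<partial>M) = cov_fun M X (s - t)"
proof -
  have "(\<integral>x. X s x * X t x \<partial>M) = (\<integral>x. X t x * X s x \<partial>M)" by (simp add: mult.commute)
  then show ?thesis using stationary by (simp add: stationary_cov_def)
qed

text \<open>Both sides expand to the same double sum of covariances at \<open>t i - s j\<close>,
  with \<open>X r\<close> corresponding to \<open>cis (r \<bullet> x)\<close>. Two different
  combinations are kept so that both the norm and the pairing identity follow.\<close>

lemma spectral_isometry:
  "complex_of_real (\<integral>x. (\<Sum>i<n. c i * X (t i) x) * (\<Sum>j<m. e j * X (s j) x) \<partial>M) =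
    (\<integral>x. trig_sum n c t x * cnj (trig_sum m e s x) \<partial>F)"
proof -
  have lX: "lin_comb X UNIV (X r)" for r by (rule lin_comb_point) simp
  have "(\<integral>x. (\<Sum>i<n. c i * X (t i) x) * (\<Sum>j<m. e j * X (s j) x) \<partial>M) =
      (\<integral>x. (\<Sum>i<n. \<Sum>j<m. (c i * e j) * (X (t i) x * X (s j) x)) \<partial>M)"
    by (simp add: sum_product mult_ac)
  also have "\<dots> = (\<Sum>i<n. \<Sum>j<m. (c i * e j) * cov_fun M X (t i - s j))"
    using lin_comb_mult_integrable[OF lX lX]
    by (subst Bochner_Integration.integral_sum, simp)+ (simp add: cov_eq)
  finally have 1: "complex_of_real (\<integral>x. (\<Sum>i<n. c i * X (t i) x) * (\<Sum>j<m. e j * X (s j) x) \<partial>M) =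
      (\<Sum>i<n. \<Sum>j<m. of_real (c i * e j) * of_real (cov_fun M X (t i - s j)))" by simp
  have int: "integrable F (\<lambda>x. cis (r \<bullet> x))" for r
  proof (rule integrable_bounded_finite_measure[OF finite_F, of _ 1])
    have "(\<lambda>x. cis (r \<bullet> x)) \<in> borel_measurable borel"
      unfolding cis_conv_exp by (intro borel_measurable_continuous_onI continuous_intros)
    then show "(\<lambda>x. cis (r \<bullet> x)) \<in> borel_measurable F" by measurable
  qed simp
  have cis_diff: "cis ((r - r') \<bullet> x) = cis (r \<bullet> x) * cnj (cis (r' \<bullet> x))" for r r' x :: 'd
    by (simp add: inner_diff_left cis_cnj cis_mult)
  have "(\<integral>x. trig_sum n c t x * cnj (trig_sum m e s x) \<partial>F) =
      (\<integral>x. (\<Sum>i<n. \<Sum>j<m. of_real (c i * e j) * cis ((t i - s j) \<bullet> x)) \<partial>F)"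
    by (simp add: trig_sum_def sum_product cis_diff mult_ac)
  also have "\<dots> = (\<Sum>i<n. \<Sum>j<m. of_real (c i * e j) * (\<integral>x. cis ((t i - s j) \<bullet> x) \<partial>F))"
    using int by (subst Bochner_Integration.integral_sum, simp)+ simp
  also have "\<dots> = (\<Sum>i<n. \<Sum>j<m. of_real (c i * e j) * of_real (cov_fun M X (t i - s j)))"
    using spectral by (simp add: spectral_measure_of_def)
  finally show ?thesis using 1 by simp
qed

lemma spectral_norm:
  "(\<integral>x. (\<Sum>i<n. c i * X (t i) x)\<^sup>2 \<partial>M) = (\<integral>x. (cmod (trig_sum n c t x))\<^sup>2 \<partial>F)"
proof -
  have "complex_of_real (\<integral>x. (\<Sum>i<n. c i * X (t i) x)\<^sup>2 \<partial>M) = (\<integral>x. of_real ((cmod (trig_sum n c t x))\<^sup>2) \<partial>F)"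
    unfolding power2_eq_square[of "sum _ _"] spectral_isometry complex_norm_square ..
  then show ?thesis unfolding integral_complex_of_real of_real_eq_iff .
qed

lemma integrable_norm_trig_sum: "integrable F (\<lambda>x. (cmod (trig_sum n c t x))\<^sup>2)"
  by (rule integrable_bounded_finite_measure[OF finite_F, of _ "(\<Sum>i<n. \<bar>c i\<bar>)\<^sup>2"])
    (auto intro!: power_mono norm_trig_sum_le)

lemma trig_sum_in_H_F: "trig_sum n c t \<in> H_F F"
  unfolding H_F_def using integrable_norm_trig_sum
  by (auto simp: Re_trig_sum Im_trig_sum sum_negf)

text \<open>One-term case of the isometry. Its left side is real, so trigonometric sums satisfy the
  condition on the imaginary part in \<open>C_a\<close> automatically.\<close>

lemma spectral_pairing:
  "complex_of_real (w_H M X (\<lambda>x. \<Sum>i<n. c i * X (t i) x) r) =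
    (\<integral>x. cis (r \<bullet> x) * cnj (trig_sum n c t x) \<partial>F)"
  using spectral_isometry[of "\<lambda>_. 1" "\<lambda>_. r" 1 c t n] by (simp add: w_H_def trig_sum_def[of "Suc 0"])

text \<open>Analogue of \<open>convex_comb_pairing_bound\<close> within \<open>L^2(F)\<close>. The
  isometry transports the convex combination there, so \<open>h\<close> never has to be realised as
  a random variable.\<close>

lemma spectral_pairing_bound:
  assumes h: "h \<in> H_F F" and w: "\<And>t. t \<in> K \<Longrightarrow> 1 < Re (\<integral>x. cis (t \<bullet> x) * cnj (h x) \<partial>F)"
    and q: "(\<integral>x. (cmod (h x))\<^sup>2 \<partial>F) \<le> q" "0 < q" and Y: "convex_comb X K Y"
  shows "1 / q \<le> (\<integral>x. (Y x)\<^sup>2 \<partial>M)"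
proof -
  have hm[measurable]: "h \<in> borel_measurable F" and ih: "integrable F (\<lambda>x. (cmod (h x))\<^sup>2)"
    using h by (auto simp: H_F_def)
  obtain n :: nat and c t where *: "\<forall>i<n. t i \<in> K \<and> 0 \<le> c i" "(\<Sum>i<n. c i) = 1"
    "Y = (\<lambda>\<omega>. \<Sum>i<n. c i * X (t i) \<omega>)"
    using Y unfolding convex_comb_def by blast
  let ?g = "trig_sum n c t"
  have cm: "(\<lambda>x. cnj (h x)) \<in> borel_measurable F"
    by (rule borel_measurable_continuous_on[OF _ hm]) (intro continuous_intros)
  have [measurable]: "trig_sum n c t \<in> borel_measurable F" for n c t by measurable
  have int: "integrable F (\<lambda>x. trig_sum n c t x * cnj (h x))" for n c t
  proof (rule Bochner_Integration.integrable_bound)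
    show "integrable F (\<lambda>x. (cmod (trig_sum n c t x))\<^sup>2 + (cmod (h x))\<^sup>2)"
      using integrable_norm_trig_sum ih by simp
    have "a * b \<le> a\<^sup>2 + b\<^sup>2" for a b :: real
      using sum_squares_bound[of a b] zero_le_power2[of a] zero_le_power2[of b]
      unfolding mult.assoc by linarith
    then show "AE x in F. norm (trig_sum n c t x * cnj (h x)) \<le> norm ((cmod (trig_sum n c t x))\<^sup>2 + (cmod (h x))\<^sup>2)"
      by (simp add: norm_mult)
  qed (use cm in measurable)
  have ic: "integrable F (\<lambda>x. cis (r \<bullet> x) * cnj (h x))" for r
    using int[of 1 "\<lambda>_. 1" "\<lambda>_. r"] by (simp add: trig_sum_def)
  have "(\<integral>x. ?g x * cnj (h x) \<partial>F) = (\<integral>x. (\<Sum>i<n. of_real (c i) * (cis (t i \<bullet> x) * cnj (h x))) \<partial>F)"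
    by (simp add: trig_sum_def sum_distrib_right mult.assoc)
  also have "\<dots> = (\<Sum>i<n. of_real (c i) * (\<integral>x. cis (t i \<bullet> x) * cnj (h x) \<partial>F))"
    using ic by (subst Bochner_Integration.integral_sum) auto
  finally have "Re (\<integral>x. ?g x * cnj (h x) \<partial>F) = (\<Sum>i<n. c i * Re (\<integral>x. cis (t i \<bullet> x) * cnj (h x) \<partial>F))"
    by simp
  also have "1 \<le> \<dots>" using * w by (intro convex_sum_ge) (auto intro: less_imp_le)
  finally have gh: "1 \<le> (\<integral>x. Re (?g x * cnj (h x)) \<partial>F)" unfolding integral_Re[OF int] .
  have expand: "(cmod (z - of_real r * y))\<^sup>2 = (cmod z)\<^sup>2 - 2 * r * Re (z * cnj y) + r\<^sup>2 * (cmod y)\<^sup>2" for z y r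
    unfolding cmod_power2 by (simp add: power2_eq_square algebra_simps)
  have "0 \<le> (\<integral>x. (cmod (?g x - of_real (1 / q) * h x))\<^sup>2 \<partial>F)" by simp
  also have "\<dots> = (\<integral>x. (cmod (?g x))\<^sup>2 - 2 * (1 / q) * Re (?g x * cnj (h x)) + (1 / q)\<^sup>2 * (cmod (h x))\<^sup>2 \<partial>F)"
    unfolding expand ..
  also have "\<dots> = (\<integral>x. (cmod (?g x))\<^sup>2 \<partial>F) - 2 * (1 / q) * (\<integral>x. Re (?g x * cnj (h x)) \<partial>F) + (1 / q)\<^sup>2 * (\<integral>x. (cmod (h x))\<^sup>2 \<partial>F)"
    using integrable_norm_trig_sum ih integrable_Re[OF int] by (simp del: times_complex.sel)
  finally have 0: "0 \<le> \<dots>" .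
  have 1: "2 * (1 / q) * 1 \<le> 2 * (1 / q) * (\<integral>x. Re (?g x * cnj (h x)) \<partial>F)" using gh q by (intro mult_left_mono) auto
  have "(1 / q)\<^sup>2 * (\<integral>x. (cmod (h x))\<^sup>2 \<partial>F) \<le> (1 / q)\<^sup>2 * q" using q by (intro mult_left_mono) auto
  also have "\<dots> = 1 / q" using q(2) by (simp add: power2_eq_square)
  finally have "1 / q \<le> (\<integral>x. (cmod (?g x))\<^sup>2 \<partial>F)" using 0 1 by linarith
  then show ?thesis by (simp add: *(3) spectral_norm)
qed

text \<open>A path leaving a large ball contains \<open>n\<close> points at pairwise distance at least \<open>\<rho>\<close>; their average
  has variance at most \<open>cov_fun M X 0 / n + \<epsilon>\<close>, so such paths have arbitrarily large cost.\<close>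

lemma convex_comb_separated_variance:
  assumes n: "0 < n" and t: "\<And>i. i < n \<Longrightarrow> t i \<in> K \<and> norm (t i) = real i * \<rho>" and \<rho>: "0 < \<rho>" and \<epsilon>: "0 \<le> \<epsilon>"
    and cov: "\<And>r. \<rho> \<le> norm r \<Longrightarrow> cov_fun M X r \<le> \<epsilon>"
  shows "\<exists>Y. convex_comb X K Y \<and> (\<integral>x. (Y x)\<^sup>2 \<partial>M) \<le> cov_fun M X 0 / n + \<epsilon>"
proof -
  define Y where "Y = (\<lambda>x. \<Sum>i<n. 1 / real n * X (t i) x)"
  have "convex_comb X K Y" unfolding convex_comb_def Y_def
    using n t by (intro exI[of _ n] exI[of _ "\<lambda>_. 1 / real n"] exI[of _ t]) auto
  moreover have "(\<integral>x. (Y x)\<^sup>2 \<partial>M) \<le> cov_fun M X 0 / n + \<epsilon>"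
  proof -
    have lX: "lin_comb X UNIV (X r)" for r by (rule lin_comb_point) simp
    have c0: "0 \<le> cov_fun M X 0" by (simp add: cov_fun_def)
    have "(\<integral>x. (Y x)\<^sup>2 \<partial>M) = (\<integral>x. (\<Sum>i<n. \<Sum>j<n. (1 / real n * (1 / real n)) * (X (t i) x * X (t j) x)) \<partial>M)"
      by (simp add: Y_def power2_eq_square[of "sum _ _"] sum_product mult_ac)
    also have "\<dots> = (\<Sum>i<n. \<Sum>j<n. (1 / real n * (1 / real n)) * cov_fun M X (t i - t j))"
      using lin_comb_mult_integrable[OF lX lX]
      by (subst Bochner_Integration.integral_sum, simp)+ (simp add: cov_eq)
    \<comment> \<open>Adding \<open>\<epsilon>\<close> on the diagonal as well keeps the double sum
      in closed form. Off the diagonal, the radii are distinct multiples of \<open>\<rho>\<close>,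
      which forces distance at least \<open>\<rho>\<close>.\<close>
    also have "\<dots> \<le> (\<Sum>i<n. \<Sum>j<n. (1 / real n * (1 / real n)) * ((if i = j then cov_fun M X 0 else 0) + \<epsilon>))"
    proof (intro sum_mono mult_left_mono)
      fix i j assume ij: "i \<in> {..<n}" "j \<in> {..<n}"
      show "cov_fun M X (t i - t j) \<le> (if i = j then cov_fun M X 0 else 0) + \<epsilon>"
      proof (cases "i = j")
        case False
        have "1 \<le> \<bar>real i - real j\<bar>" using False by linarith
        then have "1 * \<rho> \<le> \<bar>real i - real j\<bar> * \<rho>" using \<rho> by (intro mult_right_mono) auto
        also have "\<dots> = \<bar>norm (t i) - norm (t j)\<bar>"
          using t[of i] t[of j] ij \<rho> by (simp add: left_diff_distrib[symmetric] abs_mult)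
        also have "\<dots> \<le> norm (t i - t j)" by (rule norm_triangle_ineq3)
        finally show ?thesis using cov False by simp
      qed (use \<epsilon> in simp)
    qed simp
    also have "\<dots> = (1 / real n * (1 / real n)) * (\<Sum>i<n. \<Sum>j<n. (if i = j then cov_fun M X 0 else 0) + \<epsilon>)"
      by (simp only: sum_distrib_left)
    also have "(\<Sum>i<n. \<Sum>j<n. (if i = j then cov_fun M X 0 else 0) + \<epsilon>) = real n * (cov_fun M X 0 + real n * \<epsilon>)"
      by (simp add: sum.distrib)
    also have "1 / real n * (1 / real n) * (real n * (cov_fun M X 0 + real n * \<epsilon>)) = cov_fun M X 0 / n + \<epsilon>"
      using n by (simp add: field_simps)
    finally show ?thesis .
  qed
  ultimately show ?thesis by blast
qed

end

section \<open>Stationary fields on the whole space\<close>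

lemma excursion_rate_stationary:
  fixes X :: "'d::euclidean_space \<Rightarrow> 'a \<Rightarrow> real"
  assumes M: "prob_space M" and X: "centered_gaussian_field M X UNIV" "continuous_paths M X UNIV"
    and stat: "stationary_cov M X" and F: "spectral_measure_of M X F"
    and lim: "Limsup at_infinity (\<lambda>t. ereal (cov_fun M X t)) \<le> 0"
  shows "((\<lambda>u. eln (Psi_a M X a u) / ereal (u\<^sup>2)) \<longlongrightarrow> - C_a F a / 2) at_top"
proof -
  interpret gaussian_field M X UNIV using X M by (intro gaussian_field_subset[of M X UNIV UNIV]) auto
  interpret spectral_field M X F by standard fact+
  define S where "S u = {\<omega>\<in>space M. \<exists>\<xi>\<in>paths_from_to 0 a. \<forall>v\<in>{0..1}. X (\<xi> v) \<omega> > u}" for u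
  have Psi: "Psi_a M X a u = outer_prob M (S u)" for u by (simp add: Psi_a_def S_def)
  show ?thesis
  proof (rule eln_rate_tendsto)
    show "0 \<le> C_a F a" unfolding C_a_def by (rule Inf_greatest) auto
    show "Psi_a M X a u \<le> 1" for u
      unfolding Psi using outer_prob_le[of "S u" "space M" M] by (auto simp: S_def prob_space)
  next
    fix c assume c: "0 < c" "ereal c < C_a F a"
    obtain c2 where c2: "ereal c < ereal c2" "ereal c2 < C_a F a" using ereal_dense2[OF c(2)] by blast
    define c1 where "c1 = (c + c2) / 2"
    have c1: "0 < c1" "c < c1" "c1 < c2" using c c2 by (auto simp: c1_def)
    \<comment> \<open>The target variance \<open>1 / c1\<close> is split evenly: one
      \<open>\<epsilon>\<close> bounds the distant covariances, and \<open>n\<close> is taken so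
      large that the diagonal contributes at most the other.\<close>
    define \<epsilon> where "\<epsilon> = 1 / (2 * c1)"
    have \<epsilon>: "0 < \<epsilon>" using c1 by (simp add: \<epsilon>_def)
    have "Limsup at_infinity (\<lambda>t. ereal (cov_fun M X t)) < ereal \<epsilon>"
      using lim \<epsilon> by (simp add: le_less_trans)
    then have "\<forall>\<^sub>F t in at_infinity. ereal (cov_fun M X t) < ereal \<epsilon>" by (rule Limsup_lessD)
    then obtain \<rho>' where \<rho>': "\<And>r. \<rho>' \<le> norm r \<Longrightarrow> cov_fun M X r < \<epsilon>" by (auto simp: eventually_at_infinity)
    define \<rho> where "\<rho> = max 1 \<rho>'"
    have \<rho>: "0 < \<rho>" "\<And>r. \<rho> \<le> norm r \<Longrightarrow> cov_fun M X r \<le> \<epsilon>"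
      using \<rho>' by (auto simp: \<rho>_def intro: less_imp_le)
    obtain n' :: nat where n': "2 * c1 * cov_fun M X 0 \<le> real n'" using real_arch_simple by blast
    define n where "n = Suc n'"
    have n: "0 < n" "cov_fun M X 0 / n + \<epsilon> \<le> 1 / c1"
    proof -
      have "2 * c1 * cov_fun M X 0 \<le> real n" using n' by (simp add: n_def)
      then have "cov_fun M X 0 / real n \<le> \<epsilon>"
        using c1(1) by (simp add: \<epsilon>_def n_def pos_divide_le_eq pos_le_divide_eq mult_ac)
      moreover have "\<epsilon> + \<epsilon> = 1 / c1" using c1(1) by (simp add: \<epsilon>_def field_simps)
      ultimately show "cov_fun M X 0 / n + \<epsilon> \<le> 1 / c1" by linarith
    qed (simp add: n_def)
    define R where "R = real n * \<rho>"
    have cB: "compact (cball (0::'d) R)" by simp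
    interpret B: gaussian_field M X "cball 0 R" using X M by (intro gaussian_field_subset[of M X UNIV]) auto
    \<comment> \<open>The upper bound needs a compact parameter set, so path images are cut off at a
      ball containing all radii \<open>i * \<rho>\<close> with \<open>i < n\<close>. An excursion
      along the path implies one on the part that remains.\<close>
    define \<K> where "\<K> = {\<xi> ` {0..1} \<inter> cball 0 R | \<xi>. \<xi> \<in> paths_from_to 0 a}"
    have "\<forall>\<^sub>F u in at_top. \<exists>E\<in>events. {\<omega>\<in>space M. \<exists>K\<in>\<K>. \<forall>t\<in>K. u < X t \<omega>} \<subseteq> E \<and> prob E \<le> exp (- c * u\<^sup>2 / 2)"
    proof (rule B.excursion_probability_upper[OF cB, of "1 / c1"])
      fix K assume "K \<in> \<K>"
      then obtain \<xi> where K: "K = \<xi> ` {0..1} \<inter> cball 0 R" and \<xi>: "\<xi> \<in> paths_from_to 0 a"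
        unfolding \<K>_def by blast
      show KT: "K \<subseteq> cball 0 R" using K by blast
      have \<xi>0: "\<xi> 0 = 0" and \<xi>c: "continuous_on {0..1} \<xi>" using \<xi> by (auto simp: paths_from_to_def)
      show "\<exists>Y. convex_comb X K Y \<and> (\<integral>x. (Y x)\<^sup>2 \<partial>M) \<le> 1 / c1"
      \<comment> \<open>Cutting changes nothing for a path inside the ball, so its cost compares
        with \<open>C_a\<close>. Otherwise the remaining set need not be a path image, which the
        upper bound permits.\<close>
      proof (cases "\<forall>v\<in>{0..1}. \<xi> v \<in> cball 0 R")
        case True
        then have K': "K = \<xi> ` {0..1}" using K by blast
        show ?thesis
        proof (rule B.convex_comb_of_admissible_bound[OF KT cB _ c1(1,3)])
          show "K \<noteq> {}" using K' by simp
          fix H assume H: "lin_comb X K H" "\<forall>t\<in>K. 1 < w_H M X H t"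
          obtain m :: nat and e t where Hc: "H = (\<lambda>x. \<Sum>i<m. e i * X (t i) x)"
            using H(1) unfolding lin_comb_def by blast
          have pair: "(\<integral>x. cis (r \<bullet> x) * cnj (trig_sum m e t x) \<partial>F) = of_real (w_H M X H r)" for r
            unfolding Hc by (rule spectral_pairing[symmetric])
          have adm: "\<exists>\<xi>\<in>paths_from_to 0 a. \<forall>v\<in>{0..1}.
              Im (\<integral>x. cis (\<xi> v \<bullet> x) * cnj (trig_sum m e t x) \<partial>F) = 0 \<and>
              Re (\<integral>x. cis (\<xi> v \<bullet> x) * cnj (trig_sum m e t x) \<partial>F) > 1"
            unfolding pair using \<xi> H(2) by (intro bexI[of _ \<xi>]) (auto simp: K')
          have "C_a F a \<le> ereal (\<integral>x. (cmod (trig_sum m e t x))\<^sup>2 \<partial>F)"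
            unfolding C_a_def
            by (rule Inf_lower, rule CollectI, rule exI[of _ "trig_sum m e t"], intro conjI refl trig_sum_in_H_F adm)
          with c2(2) have "ereal c2 < ereal (\<integral>x. (cmod (trig_sum m e t x))\<^sup>2 \<partial>F)" by (rule less_le_trans)
          then show "c2 \<le> (\<integral>x. (H x)\<^sup>2 \<partial>M)" by (simp add: Hc spectral_norm)
        qed
      next
        case False
        then obtain v where v: "v \<in> {0..1}" "R < norm (\<xi> v)" by auto
        have "\<exists>r. r \<in> K \<and> norm r = real i * \<rho>" if i: "i < n" for i
        proof -
          have iR: "real i * \<rho> \<le> R" unfolding R_def using i \<rho> by (intro mult_right_mono) auto
          \<comment> \<open>The path starts at the origin, so up to time \<open>v\<close> its norm
            takes every value between \<open>0\<close> and a number above \<open>R\<close>.\<close>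
          have "\<exists>x\<ge>0. x \<le> v \<and> norm (\<xi> x) = real i * \<rho>"
          proof (rule IVT')
            show "norm (\<xi> 0) \<le> real i * \<rho>" using \<xi>0 \<rho> by simp
            show "real i * \<rho> \<le> norm (\<xi> v)" using iR v by simp
            show "0 \<le> v" using v by simp
            show "continuous_on {0..v} (\<lambda>x. norm (\<xi> x))"
              using v by (intro continuous_intros continuous_on_subset[OF \<xi>c]) auto
          qed
          then obtain x where x: "0 \<le> x" "x \<le> v" "norm (\<xi> x) = real i * \<rho>" by blast
          have "\<xi> x \<in> K" unfolding K using x v iR by auto
          then show ?thesis using x(3) by blast
        qed
        then obtain t where t: "\<And>i. i < n \<Longrightarrow> t i \<in> K \<and> norm (t i) = real i * \<rho>" by metis
        have "\<exists>Y. convex_comb X K Y \<and> (\<integral>x. (Y x)\<^sup>2 \<partial>M) \<le> cov_fun M X 0 / n + \<epsilon>"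
          by (rule convex_comb_separated_variance[OF n(1) t \<rho>(1) less_imp_le[OF \<epsilon>] \<rho>(2)])
        then show ?thesis using n(2) by (meson order_trans)
      qed
    qed (use c c1 in auto)
    then show "\<forall>\<^sub>F u in at_top. Psi_a M X a u \<le> exp (- c * u\<^sup>2 / 2)"
    proof (rule eventually_mono)
      fix u assume "\<exists>E\<in>events. {\<omega>\<in>space M. \<exists>K\<in>\<K>. \<forall>t\<in>K. u < X t \<omega>} \<subseteq> E \<and> prob E \<le> exp (- c * u\<^sup>2 / 2)"
      then obtain E where E: "E \<in> events" "{\<omega>\<in>space M. \<exists>K\<in>\<K>. \<forall>t\<in>K. u < X t \<omega>} \<subseteq> E" "prob E \<le> exp (- c * u\<^sup>2 / 2)"
        by blast
      have "S u \<subseteq> {\<omega>\<in>space M. \<exists>K\<in>\<K>. \<forall>t\<in>K. u < X t \<omega>}"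
      proof (rule subsetI)
        fix \<omega> assume "\<omega> \<in> S u"
        then obtain \<xi> where \<xi>: "\<omega> \<in> space M" "\<xi> \<in> paths_from_to 0 a" "\<forall>v\<in>{0..1}. X (\<xi> v) \<omega> > u"
          unfolding S_def by blast
        have "\<xi> ` {0..1} \<inter> cball 0 R \<in> \<K>" unfolding \<K>_def using \<xi>(2) by blast
        moreover have "\<forall>t\<in>\<xi> ` {0..1} \<inter> cball 0 R. u < X t \<omega>" using \<xi>(3) by blast
        ultimately show "\<omega> \<in> {\<omega>\<in>space M. \<exists>K\<in>\<K>. \<forall>t\<in>K. u < X t \<omega>}" using \<xi>(1) by blast
      qed
      with E have "outer_prob M (S u) \<le> prob E" by (intro outer_prob_le) auto
      then show "Psi_a M X a u \<le> exp (- c * u\<^sup>2 / 2)" unfolding Psi using E(3) by simp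
    qed
  next
    fix q assume "C_a F a < ereal q"
    then obtain h \<xi> where h: "h \<in> H_F F" "(\<integral>x. (cmod (h x))\<^sup>2 \<partial>F) < q"
      and \<xi>: "\<xi> \<in> paths_from_to 0 a" "\<And>v. v \<in> {0..1} \<Longrightarrow> 1 < Re (\<integral>x. cis (\<xi> v \<bullet> x) * cnj (h x) \<partial>F)"
      unfolding C_a_def Inf_less_iff by auto
    define K where "K = \<xi> ` {0..1}"
    have K: "compact K" "K \<noteq> {}"
      using \<xi>(1) unfolding K_def by (auto intro!: compact_continuous_image simp: paths_from_to_def)
    define q1 where "q1 = ((\<integral>x. (cmod (h x))\<^sup>2 \<partial>F) + q) / 2"
    have "0 \<le> (\<integral>x. (cmod (h x))\<^sup>2 \<partial>F)" by simp
    then have "0 < q" using h(2) by linarith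
    then have q1: "(\<integral>x. (cmod (h x))\<^sup>2 \<partial>F) \<le> q1" "0 < q1" "q1 < q"
      using h(2) by (auto simp: q1_def intro: add_nonneg_pos)
    have "\<forall>\<^sub>F u in at_top. \<exists>E\<in>events. E \<subseteq> {\<omega>\<in>space M. \<forall>t\<in>K. u < X t \<omega>} \<and> exp (- q * u\<^sup>2 / 2) \<le> prob E"
    proof (rule excursion_probability_lower_of_convex_bound[OF _ K q1(2,3)])
      show "1 / q1 \<le> (\<integral>x. (Y x)\<^sup>2 \<partial>M)" if "convex_comb X K Y" for Y
        by (rule spectral_pairing_bound[OF h(1) _ q1(1,2) that]) (use \<xi>(2) in \<open>auto simp: K_def\<close>)
    qed simp
    then show "\<forall>\<^sub>F u in at_top. exp (- q * u\<^sup>2 / 2) \<le> Psi_a M X a u"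
    proof (rule eventually_mono)
      fix u assume "\<exists>E\<in>events. E \<subseteq> {\<omega>\<in>space M. \<forall>t\<in>K. u < X t \<omega>} \<and> exp (- q * u\<^sup>2 / 2) \<le> prob E"
      then obtain E where E: "E \<in> events" "E \<subseteq> {\<omega>\<in>space M. \<forall>t\<in>K. u < X t \<omega>}" "exp (- q * u\<^sup>2 / 2) \<le> prob E"
        by blast
      have "E \<subseteq> S u" using E(2) \<xi>(1) unfolding S_def K_def by blast
      then have "prob E \<le> outer_prob M (S u)"
        using E(1) by (intro outer_prob_ge finite_measure_axioms) (auto simp: S_def)
      then show "exp (- q * u\<^sup>2 / 2) \<le> Psi_a M X a u" unfolding Psi using E(3) by simp
    qed
  qed
qed

theorem theorem3p1:
  shows
  "(\<forall>(M::'a measure) (X::'d::euclidean_space \<Rightarrow> 'a \<Rightarrow> real) T a b.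
      prob_space M \<and> compact T \<and> centered_gaussian_field M X T \<and>
      continuous_paths M X T \<and> a \<in> T \<and> b \<in> T \<and> a \<noteq> b \<and>
      (\<exists>\<xi>\<in>paths_from_to a b. \<forall>v\<in>{0..1}. \<xi> v \<in> T)
      \<longrightarrow> ((\<lambda>u. eln (Psi_ab M X T a b u) / ereal (u\<^sup>2)) \<longlongrightarrow> - C_ab M X T a b / 2) at_top)
   \<and>
   (\<forall>(M::'a measure) (X::'d \<Rightarrow> 'a \<Rightarrow> real) F a.
      prob_space M \<and> centered_gaussian_field M X UNIV \<and>
      continuous_paths M X UNIV \<and> stationary_cov M X \<and>
      spectral_measure_of M X F \<and>
      Limsup at_infinity (\<lambda>t. ereal (cov_fun M X t)) \<le> 0 \<and> a \<noteq> 0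
      \<longrightarrow> ((\<lambda>u. eln (Psi_a M X a u) / ereal (u\<^sup>2)) \<longlongrightarrow> - C_a F a / 2) at_top)"
  by (intro conjI allI impI excursion_rate_compact excursion_rate_stationary; elim conjE; assumption)

end
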